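(* Let $H$ be an arbitrary Hilbert space. Then the left contractive modules $L\otimes H$ and $L\mathbin{\dot\otimes}H$ are ESR-flat.
   Context: All spaces are complex; normed spaces need not be complete. $L$ is a fixed separable infinite-dimensional Hilbert space, $\mathcal B=\mathcal B(L)$ is the algebra of all bounded operators on $L$ with operator norm. "Left module" and "right module" mean unital module over $\mathcal B$; morphisms are $\mathcal B$-module morphisms (linear). Module multiplications are denoted by a dot. A projection is a self-adjoint idempotent in $\mathcal B$. "Isometric" means norm-preserving (not necessarily surjective). A left (right) module $X$ that is a normed space is contractive if $\|a\cdot u\|\le\|a\|\|u\|$ (resp. $\|u\cdot a\|\le\|a\|\|u\|$) for all $a\in\mathcal B,u\in X$. A right support of an element $u$ of a right module is a projection $P\in\mathcal B$ with $u\cdot P=u$. A right semi-Ruan module is a contractive right module such that $\|u+v\|\le(\|u\|^2+\|v\|^2)^{1/2}$ whenever $u,v$ have orthogonal right supports (i.e. there are right supports $P$ of $u$ and $Q$ of $v$ with $PQ=0$). For a contractive right module $Y$ and a contractive left module $X$, $Y\otimes_{\mathcal B}X$ is the normed quotient space $(Y\otimes_p X)/N_1$, where $\otimes_p$ is the non-completed projective tensor product of normed spaces and $N_1$ is the closure of $\mathrm{span}\{y\cdot a\otimes x-y\otimes a\cdot x: a\in\mathcal B,x\in X,y\in Y\}$; the coset of $y\otimes x$ is written $y\otimes_{\mathcal B}x$. For a bounded right module morphism $\alpha:Y\to Z$, $\alpha\otimes_{\mathcal B}\mathbf 1_X:Y\otimes_{\mathcal B}X\to Z\otimes_{\mathcal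 B}X$ is the bounded operator determined by $y\otimes_{\mathcal B}x\mapsto\alpha(y)\otimes_{\mathcal B}x$. A contractive left module $X$ is ESR-flat if for every isometric morphism $\alpha:Y\to Z$ of right semi-Ruan modules the operator $\alpha\otimes_{\mathcal B}\mathbf 1_X$ is isometric. $L\mathbin{\dot\otimes}H$ denotes the Hilbert (completed) tensor product, a contractive left module with $a\cdot\zeta:=(a\mathbin{\dot\otimes}\mathbf 1_H)\zeta$; $L\otimes H$ denotes the algebraic tensor product, taken as a submodule of $L\mathbin{\dot\otimes}H$ with the induced norm. *)

theory Defs
  imports "HOL-Analysis.Analysis" "HOL-Library.Set_Algebras" "HOL-Library.Poly_Mapping"
begin

section \<open>Complex normed spaces and Hilbert spaces\<close>

class complex_vector = ab_group_add +
  fixes scaleC :: "complex \<Rightarrow> 'a \<Rightarrow> 'a"  (infixr \<open>*\<^sub>C\<close> 75)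
  assumes scaleC_add_right: "c *\<^sub>C (x + y) = c *\<^sub>C x + c *\<^sub>C y"
    and scaleC_add_left: "(c + d) *\<^sub>C x = c *\<^sub>C x + d *\<^sub>C x"
    and scaleC_scaleC: "c *\<^sub>C d *\<^sub>C x = (c * d) *\<^sub>C x"
    and scaleC_one: "1 *\<^sub>C x = x"

global_interpretation cvec: vector_space "scaleC :: complex \<Rightarrow> 'a \<Rightarrow> 'a::complex_vector"
  defines cspan = cvec.span and csubspace = cvec.subspace
  by unfold_locales (rule scaleC_add_right scaleC_add_left scaleC_scaleC scaleC_one)+

text \<open>
  The underlying real normed space is part of the structure, so that the norm, the topology and
  the operator norm of the library are available. Completeness is not required.
\<close>

class complex_normed_vector = complex_vector + real_normed_vector +
  assumes scaleC_of_real: "complex_of_real r *\<^sub>C x = r *\<^sub>R x"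
    and norm_scaleC: "norm (c *\<^sub>C x) = cmod c * norm x"

text \<open>The inner product is linear in its first argument.\<close>

class complex_inner = complex_normed_vector +
  fixes cinner :: "'a \<Rightarrow> 'a \<Rightarrow> complex"
  assumes cinner_commute: "cinner x y = cnj (cinner y x)"
    and cinner_add_left: "cinner (x + y) z = cinner x z + cinner y z"
    and cinner_scaleC_left: "cinner (c *\<^sub>C x) y = c * cinner x y"
    and cinner_same: "cinner x x = complex_of_real ((norm x)\<^sup>2)"

class chilbert_space = complex_inner + complete_space

instantiation complex :: complex_vector
begin
definition scaleC_complex :: "complex \<Rightarrow> complex \<Rightarrow> complex" where
  "scaleC_complex c x = c * x"
instance
  by standard (simp_all add: scaleC_complex_def algebra_simps)
end

instantiation poly_mapping :: (type, complex_vector) complex_vector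
begin
lift_definition scaleC_poly_mapping ::
  "complex \<Rightarrow> ('a \<Rightarrow>\<^sub>0 'b) \<Rightarrow> ('a \<Rightarrow>\<^sub>0 'b)" is "\<lambda>c f k. c *\<^sub>C f k"
  by (erule finite_subset[rotated]) (auto simp: cvec.scale_zero_right)
instance
  by standard
    (transfer; simp add: fun_eq_iff scaleC_add_right scaleC_add_left scaleC_scaleC scaleC_one)+
end

lemma bounded_linear_scaleC:
  "bounded_linear (\<lambda>x::'a::complex_normed_vector. c *\<^sub>C x)"
proof (rule bounded_linear_intro[where K = "cmod c"])
  fix r and x :: 'a
  show "c *\<^sub>C (r *\<^sub>R x) = r *\<^sub>R (c *\<^sub>C x)"
    by (simp add: scaleC_scaleC mult.commute flip: scaleC_of_real)
qed (simp_all add: scaleC_add_right norm_scaleC mult.commute)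

instantiation blinfun :: (real_normed_vector, complex_normed_vector) complex_vector
begin
lift_definition scaleC_blinfun :: "complex \<Rightarrow> ('a \<Rightarrow>\<^sub>L 'b) \<Rightarrow> ('a \<Rightarrow>\<^sub>L 'b)"
  is "\<lambda>c f x. c *\<^sub>C f x"
  by (rule bounded_linear_compose[OF bounded_linear_scaleC])
instance
  by standard
    (transfer; simp add: fun_eq_iff scaleC_add_right scaleC_add_left scaleC_scaleC scaleC_one)+
end


section \<open>Bounded operators and modules over them\<close>

text \<open>
  \<open>'l \<Rightarrow>\<^sub>L 'l\<close> consists of the bounded \<^emph>\<open>real\<close>-linear operators; \<open>bops\<close> selects the complex-linear ones.
\<close>

definition bops :: "('l::complex_normed_vector \<Rightarrow>\<^sub>L 'l) set" where
  "bops = {a. \<forall>c x. blinfun_apply a (c *\<^sub>C x) = c *\<^sub>C blinfun_apply a x}"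

definition projection :: "('l::complex_inner \<Rightarrow>\<^sub>L 'l) \<Rightarrow> bool" where
  "projection P \<longleftrightarrow> P \<in> bops \<and> P o\<^sub>L P = P \<and>
     (\<forall>x y. cinner (blinfun_apply P x) y = cinner x (blinfun_apply P y))"

text \<open>
  A module is a complex subspace of a normed space together with a multiplication. The value of the
  multiplication matters only for operators in \<open>bops\<close> and for vectors in the subspace.
\<close>

definition contractive_left_module ::
  "'x::complex_normed_vector set \<Rightarrow> (('l::complex_normed_vector \<Rightarrow>\<^sub>L 'l) \<Rightarrow> 'x \<Rightarrow> 'x) \<Rightarrow> bool" where
  "contractive_left_module X m \<longleftrightarrow>
     csubspace X \<and>
     (\<forall>a\<in>bops. \<forall>x\<in>X. m a x \<in> X) \<and>
     (\<forall>a\<in>bops. \<forall>x\<in>X. \<forall>x'\<in>X. m a (x + x') = m a x + m a x') \<and>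
     (\<forall>a\<in>bops. \<forall>c. \<forall>x\<in>X. m a (c *\<^sub>C x) = c *\<^sub>C m a x) \<and>
     (\<forall>a\<in>bops. \<forall>b\<in>bops. \<forall>x\<in>X. m (a + b) x = m a x + m b x) \<and>
     (\<forall>a\<in>bops. \<forall>c. \<forall>x\<in>X. m (c *\<^sub>C a) x = c *\<^sub>C m a x) \<and>
     (\<forall>a\<in>bops. \<forall>b\<in>bops. \<forall>x\<in>X. m (a o\<^sub>L b) x = m a (m b x)) \<and>
     (\<forall>x\<in>X. m id_blinfun x = x) \<and>
     (\<forall>a\<in>bops. \<forall>x\<in>X. norm (m a x) \<le> norm a * norm x)"

definition contractive_right_module ::
  "'y::complex_normed_vector set \<Rightarrow> ('y \<Rightarrow> ('l::complex_normed_vector \<Rightarrow>\<^sub>L 'l) \<Rightarrow> 'y) \<Rightarrow> bool" where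
  "contractive_right_module Y m \<longleftrightarrow>
     csubspace Y \<and>
     (\<forall>a\<in>bops. \<forall>y\<in>Y. m y a \<in> Y) \<and>
     (\<forall>a\<in>bops. \<forall>y\<in>Y. \<forall>y'\<in>Y. m (y + y') a = m y a + m y' a) \<and>
     (\<forall>a\<in>bops. \<forall>c. \<forall>y\<in>Y. m (c *\<^sub>C y) a = c *\<^sub>C m y a) \<and>
     (\<forall>a\<in>bops. \<forall>b\<in>bops. \<forall>y\<in>Y. m y (a + b) = m y a + m y b) \<and>
     (\<forall>a\<in>bops. \<forall>c. \<forall>y\<in>Y. m y (c *\<^sub>C a) = c *\<^sub>C m y a) \<and>
     (\<forall>a\<in>bops. \<forall>b\<in>bops. \<forall>y\<in>Y. m y (a o\<^sub>L b) = m (m y a) b) \<and>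
     (\<forall>y\<in>Y. m y id_blinfun = y) \<and>
     (\<forall>a\<in>bops. \<forall>y\<in>Y. norm (m y a) \<le> norm a * norm y)"

definition right_support ::
  "('y \<Rightarrow> ('l::complex_inner \<Rightarrow>\<^sub>L 'l) \<Rightarrow> 'y) \<Rightarrow> ('l \<Rightarrow>\<^sub>L 'l) \<Rightarrow> 'y \<Rightarrow> bool" where
  "right_support m P u \<longleftrightarrow> projection P \<and> m u P = u"

definition right_semi_Ruan ::
  "'y::complex_normed_vector set \<Rightarrow> ('y \<Rightarrow> ('l::complex_inner \<Rightarrow>\<^sub>L 'l) \<Rightarrow> 'y) \<Rightarrow> bool" where
  "right_semi_Ruan Y m \<longleftrightarrow>
     contractive_right_module Y m \<and>
     (\<forall>u\<in>Y. \<forall>v\<in>Y.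
        (\<exists>P Q. right_support m P u \<and> right_support m Q v \<and> P o\<^sub>L Q = 0) \<longrightarrow>
        norm (u + v) \<le> sqrt ((norm u)\<^sup>2 + (norm v)\<^sup>2))"

definition right_morphism ::
  "'y::complex_normed_vector set \<Rightarrow> ('y \<Rightarrow> ('l::complex_normed_vector \<Rightarrow>\<^sub>L 'l) \<Rightarrow> 'y) \<Rightarrow>
   'z::complex_normed_vector set \<Rightarrow> ('z \<Rightarrow> ('l \<Rightarrow>\<^sub>L 'l) \<Rightarrow> 'z) \<Rightarrow> ('y \<Rightarrow> 'z) \<Rightarrow> bool" where
  "right_morphism Y m Z n \<alpha> \<longleftrightarrow>
     \<alpha> ` Y \<subseteq> Z \<and>
     (\<forall>y\<in>Y. \<forall>y'\<in>Y. \<alpha> (y + y') = \<alpha> y + \<alpha> y') \<and>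
     (\<forall>c. \<forall>y\<in>Y. \<alpha> (c *\<^sub>C y) = c *\<^sub>C \<alpha> y) \<and>
     (\<forall>a\<in>bops. \<forall>y\<in>Y. \<alpha> (m y a) = n (\<alpha> y) a)"


section \<open>The projective tensor product of normed spaces\<close>

text \<open>
  The algebraic tensor product of \<open>Y\<close> and \<open>X\<close> is the space of formal linear combinations of pairs,
  modulo the subspace \<open>bilin_rel Y X\<close>. Its elements are cosets (of type \<open>_ set\<close>); their sum
  is the elementwise sum of sets.
\<close>

type_synonym ('y, 'x) formal = "('y \<times> 'x) \<Rightarrow>\<^sub>0 complex"

definition pair :: "'y \<Rightarrow> 'x \<Rightarrow> ('y, 'x) formal" where
  "pair y x = Poly_Mapping.single (y, x) 1"

definition formals :: "'y set \<Rightarrow> 'x set \<Rightarrow> ('y, 'x) formal set" where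
  "formals Y X = {f. Poly_Mapping.keys f \<subseteq> Y \<times> X}"

definition bilin_rel ::
  "'y::complex_vector set \<Rightarrow> 'x::complex_vector set \<Rightarrow> ('y, 'x) formal set" where
  "bilin_rel Y X = cspan
     ({pair (y + y') x - pair y x - pair y' x | y y' x. y \<in> Y \<and> y' \<in> Y \<and> x \<in> X} \<union>
      {pair y (x + x') - pair y x - pair y x' | y x x'. y \<in> Y \<and> x \<in> X \<and> x' \<in> X} \<union>
      {pair (c *\<^sub>C y) x - c *\<^sub>C pair y x | c y x. y \<in> Y \<and> x \<in> X} \<union>
      {pair y (c *\<^sub>C x) - c *\<^sub>C pair y x | c y x. y \<in> Y \<and> x \<in> X})"

definition tensor_class ::
  "'y::complex_vector set \<Rightarrow> 'x::complex_vector set \<Rightarrow> ('y, 'x) formal \<Rightarrow> ('y, 'x) formal set" where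
  "tensor_class Y X f = f +o bilin_rel Y X"

definition alg_tensor ::
  "'y::complex_vector set \<Rightarrow> 'x::complex_vector set \<Rightarrow> ('y, 'x) formal set set" where
  "alg_tensor Y X = tensor_class Y X ` formals Y X"

text \<open>
  The infimum of the sums of \<open>\<parallel>y\<^sub>k\<parallel> \<parallel>x\<^sub>k\<parallel>\<close> over all representations of \<open>u\<close> as a sum of elementary
  tensors \<open>y\<^sub>k \<otimes> x\<^sub>k\<close>; the latter means that the corresponding formal sum belongs to the coset \<open>u\<close>.
\<close>

definition proj_norm ::
  "'y::complex_normed_vector set \<Rightarrow> 'x::complex_normed_vector set \<Rightarrow> ('y, 'x) formal set \<Rightarrow> real" where
  "proj_norm Y X u =
     Inf {\<Sum>(y, x)\<leftarrow>ps. norm y * norm x | ps.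
            set ps \<subseteq> Y \<times> X \<and> (\<Sum>(y, x)\<leftarrow>ps. pair y x) \<in> u}"


section \<open>The tensor product over the operator algebra\<close>

text \<open>
  \<open>N1\<close> is the closure, in the projective norm, of the span of all
  \<open>y \<cdot> a \<otimes> x - y \<otimes> a \<cdot> x\<close>. For cosets \<open>u\<close>, \<open>v\<close> the coset \<open>u - v\<close> is written out as
  \<open>{f - g | f \<in> u, g \<in> v}\<close>, since \<open>-\<close> on sets is the set difference.
\<close>

definition balanced_span ::
  "'y::complex_normed_vector set \<Rightarrow> ('y \<Rightarrow> ('l::complex_normed_vector \<Rightarrow>\<^sub>L 'l) \<Rightarrow> 'y) \<Rightarrow>
   'x::complex_normed_vector set \<Rightarrow> (('l \<Rightarrow>\<^sub>L 'l) \<Rightarrow> 'x \<Rightarrow> 'x) \<Rightarrow> ('y, 'x) formal set set" where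
  "balanced_span Y m X k = tensor_class Y X `
     cspan {pair (m y a) x - pair y (k a x) | y a x. y \<in> Y \<and> a \<in> bops \<and> x \<in> X}"

definition N1 ::
  "'y::complex_normed_vector set \<Rightarrow> ('y \<Rightarrow> ('l::complex_normed_vector \<Rightarrow>\<^sub>L 'l) \<Rightarrow> 'y) \<Rightarrow>
   'x::complex_normed_vector set \<Rightarrow> (('l \<Rightarrow>\<^sub>L 'l) \<Rightarrow> 'x \<Rightarrow> 'x) \<Rightarrow> ('y, 'x) formal set set" where
  "N1 Y m X k =
     {u \<in> alg_tensor Y X. \<forall>e>0. \<exists>v\<in>balanced_span Y m X k.
        proj_norm Y X {f - g | f g. f \<in> u \<and> g \<in> v} < e}"

text \<open>
  The class, in the tensor product over the operator algebra, of a formal sum; its elements are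
  cosets of \<open>N1\<close> and hence sets of cosets. The norm is the quotient norm.
\<close>

definition mod_tensor_class ::
  "'y::complex_normed_vector set \<Rightarrow> ('y \<Rightarrow> ('l::complex_normed_vector \<Rightarrow>\<^sub>L 'l) \<Rightarrow> 'y) \<Rightarrow>
   'x::complex_normed_vector set \<Rightarrow> (('l \<Rightarrow>\<^sub>L 'l) \<Rightarrow> 'x \<Rightarrow> 'x) \<Rightarrow>
   ('y, 'x) formal \<Rightarrow> ('y, 'x) formal set set" where
  "mod_tensor_class Y m X k f = tensor_class Y X f +o N1 Y m X k"

definition mod_tensor ::
  "'y::complex_normed_vector set \<Rightarrow> ('y \<Rightarrow> ('l::complex_normed_vector \<Rightarrow>\<^sub>L 'l) \<Rightarrow> 'y) \<Rightarrow>
   'x::complex_normed_vector set \<Rightarrow> (('l \<Rightarrow>\<^sub>L 'l) \<Rightarrow> 'x \<Rightarrow> 'x) \<Rightarrow> ('y, 'x) formal set set set" where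
  "mod_tensor Y m X k = (\<lambda>u. u +o N1 Y m X k) ` alg_tensor Y X"

definition mod_tensor_norm ::
  "'y::complex_normed_vector set \<Rightarrow> 'x::complex_normed_vector set \<Rightarrow> ('y, 'x) formal set set \<Rightarrow> real" where
  "mod_tensor_norm Y X U = Inf (proj_norm Y X ` U)"

text \<open>
  The operator induced by a bounded morphism \<open>\<alpha>\<close>: apply \<open>(y, x) \<mapsto> (\<alpha> y, x)\<close> to any formal sum
  representing \<open>U\<close> and take the class of the result, which does not depend on the representative.
\<close>

definition push :: "('y \<Rightarrow> 'z) \<Rightarrow> ('y, 'x) formal \<Rightarrow> ('z, 'x) formal" where
  "push \<alpha> f = (\<Sum>(y, x)\<in>Poly_Mapping.keys f. Poly_Mapping.lookup f (y, x) *\<^sub>C pair (\<alpha> y) x)"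

definition mod_tensor_map ::
  "'z::complex_normed_vector set \<Rightarrow> ('z \<Rightarrow> ('l::complex_normed_vector \<Rightarrow>\<^sub>L 'l) \<Rightarrow> 'z) \<Rightarrow>
   'x::complex_normed_vector set \<Rightarrow> (('l \<Rightarrow>\<^sub>L 'l) \<Rightarrow> 'x \<Rightarrow> 'x) \<Rightarrow> ('y \<Rightarrow> 'z) \<Rightarrow>
   ('y::complex_normed_vector, 'x) formal set set \<Rightarrow> ('z, 'x) formal set set" where
  "mod_tensor_map Z n X k \<alpha> U = the_elem ((\<lambda>f. mod_tensor_class Z n X k (push \<alpha> f)) ` \<Union>U)"


section \<open>ESR-flatness\<close>

text \<open>
  The type arguments are the types containing the right modules \<open>Y\<close> and \<open>Z\<close>; flatness means
  that the property holds for all \<open>'y\<close> and \<open>'z\<close>.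
\<close>

definition ESR_flat ::
  "'y::complex_normed_vector itself \<Rightarrow> 'z::complex_normed_vector itself \<Rightarrow>
   'x::complex_normed_vector set \<Rightarrow> (('l::complex_inner \<Rightarrow>\<^sub>L 'l) \<Rightarrow> 'x \<Rightarrow> 'x) \<Rightarrow> bool" where
  "ESR_flat _ _ X k \<longleftrightarrow>
     contractive_left_module X k \<and>
     (\<forall>(Y :: 'y set) m (Z :: 'z set) n \<alpha>.
        right_semi_Ruan Y m \<and> right_semi_Ruan Z n \<and> right_morphism Y m Z n \<alpha> \<and>
        (\<forall>y\<in>Y. norm (\<alpha> y) = norm y) \<longrightarrow>
        (\<forall>U\<in>mod_tensor Y m X k.
           mod_tensor_norm Z X (mod_tensor_map Z n X k \<alpha> U) = mod_tensor_norm Y X U))"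


section \<open>Tensor products of Hilbert spaces\<close>

text \<open>
  \<open>t\<close> realises the Hilbert space \<open>'t\<close> as the completion of the algebraic tensor product of \<open>'l\<close>
  and \<open>'h\<close> with respect to the inner product determined by
  \<open>\<langle>x \<otimes> h, x' \<otimes> h'\<rangle> = \<langle>x, x'\<rangle> \<langle>h, h'\<rangle>\<close>. The algebraic tensor product is then the span of the
  elementary tensors.
\<close>

definition hilbert_tensor ::
  "('l::chilbert_space \<Rightarrow> 'h::chilbert_space \<Rightarrow> 't::chilbert_space) \<Rightarrow> bool" where
  "hilbert_tensor t \<longleftrightarrow>
     (\<forall>x x' h. t (x + x') h = t x h + t x' h) \<and>
     (\<forall>x h h'. t x (h + h') = t x h + t x h') \<and>
     (\<forall>c x h. t (c *\<^sub>C x) h = c *\<^sub>C t x h) \<and>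
     (\<forall>c x h. t x (c *\<^sub>C h) = c *\<^sub>C t x h) \<and>
     (\<forall>x x' h h'. cinner (t x h) (t x' h') = cinner x x' * cinner h h') \<and>
     closure (cspan (range (\<lambda>(x, h). t x h))) = UNIV"

definition alg_hilbert_tensor ::
  "('l::chilbert_space \<Rightarrow> 'h::chilbert_space \<Rightarrow> 't::chilbert_space) \<Rightarrow> 't set" where
  "alg_hilbert_tensor t = cspan (range (\<lambda>(x, h). t x h))"

text \<open>The operator \<open>a \<otimes> 1\<close> on the Hilbert tensor product.\<close>

definition ampliation ::
  "('l::chilbert_space \<Rightarrow> 'h::chilbert_space \<Rightarrow> 't::chilbert_space) \<Rightarrow>
   ('l \<Rightarrow>\<^sub>L 'l) \<Rightarrow> ('t \<Rightarrow>\<^sub>L 't)" where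
  "ampliation t a =
     (THE A. A \<in> bops \<and> (\<forall>x h. blinfun_apply A (t x h) = t (blinfun_apply a x) h))"

definition hilbert_tensor_action ::
  "('l::chilbert_space \<Rightarrow> 'h::chilbert_space \<Rightarrow> 't::chilbert_space) \<Rightarrow>
   ('l \<Rightarrow>\<^sub>L 'l) \<Rightarrow> 't \<Rightarrow> 't" where
  "hilbert_tensor_action t a \<zeta> = blinfun_apply (ampliation t a) \<zeta>"

end

theory Submission
  imports Defs
begin

text \<open>Collapsing the representation leaves a single vector of \<open>Z\<close>, and
  multiplying it by a projection of the operator algebra does move it into the image without raising
  its norm. Both norm estimates of the collapse are additive in squares, whereas the cost of a
  representation is a sum of products. Each elementary tensor is therefore rescaled so that both
  factors have the same norm; the squared norms on either side are then bounded by the cost, and so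
  is the product of the two norms. The vector \<open>y\<close> is recovered exactly, not up to an
  error, because a balanced tensor whose second factors lie in some \<open>trunc_space S\<close> is
  determined by finitely many coordinates. The closure in \<open>N1\<close> is handled once: all
  estimates concern a seminorm on formal sums modulo purely algebraic relations, and its null space
  turns out to be \<open>N1\<close>.\<close>

text \<open>
  Let \<open>\<alpha> : Y \<rightarrow> Z\<close> be isometric. A finite sum \<open>\<Sum> z\<^sub>k \<otimes> x\<^sub>k\<close> with \<open>x\<^sub>k\<close> in the algebraic tensor product collapses
  to a single balanced tensor \<open>z \<otimes> x\<close> without increasing the norm: partial isometries move
  the \<open>x\<^sub>k\<close> to orthogonal finite-dimensional left supports, and the semi-Ruan inequality for the \<open>z\<^sub>k\<close> is
  combined with the theorem of Pythagoras for the \<open>x\<^sub>k\<close>. If \<open>z \<otimes> x\<close> represents the image of an element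
  \<open>u\<close> of the smaller tensor product, and \<open>q\<close> is the projection onto the left support of \<open>x\<close>, then
  \<open>z \<otimes> x = z \<cdot> q \<otimes> x\<close>, where \<open>z \<cdot> q = \<alpha> y\<close> because \<open>q\<close> is a sum of operators factoring through the
  coordinates \<open>z \<cdot> (\<xi> \<otimes> e\<^sup>*)\<close> of \<open>z \<otimes> x\<close>, which lie in \<open>\<alpha> Y\<close>. Hence \<open>u = y \<otimes> x\<close>, with the same bound on the norm.
  For vectors \<open>x\<^sub>k\<close> in the completion, truncation to finitely many vectors of \<open>H\<close> is a contraction that
  preserves the coordinates, and the elements of the algebraic part are dense.
\<close>

section \<open>Complex inner product spaces\<close>

lemma cinner_add_right: "cinner x (y + z) = cinner x y + cinner x (z::'a::complex_inner)"
  by (metis cinner_add_left cinner_commute complex_cnj_add)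

lemma cinner_scaleC_right: "cinner x (c *\<^sub>C y) = cnj c * cinner x (y::'a::complex_inner)"
  by (metis cinner_commute cinner_scaleC_left complex_cnj_mult)

lemma cinner_zero_left [simp]: "cinner 0 (x::'a::complex_inner) = 0"
  using cinner_add_left[of 0 0 x] by simp

lemma cinner_zero_right [simp]: "cinner (x::'a::complex_inner) 0 = 0"
  using cinner_add_right[of x 0 0] by simp

lemma cinner_minus_left: "cinner (- x) y = - cinner x (y::'a::complex_inner)"
  using cinner_add_left[of x "- x" y] by (simp add: eq_neg_iff_add_eq_0 add.commute)

lemma cinner_diff_left: "cinner (x - y) z = cinner x z - cinner y (z::'a::complex_inner)"
  using cinner_add_left[of x "- y" z] by (simp add: cinner_minus_left)

lemma cinner_sum_left: "cinner (\<Sum>i\<in>S. f i) y = (\<Sum>i\<in>S. cinner (f i) (y::'a::complex_inner))"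
  by (induction S rule: infinite_finite_induct) (auto simp: cinner_add_left)

lemma cinner_sum_right: "cinner y (\<Sum>i\<in>S. f i) = (\<Sum>i\<in>S. cinner (y::'a::complex_inner) (f i))"
  by (induction S rule: infinite_finite_induct) (auto simp: cinner_add_right)

lemma cinner_eq_0_commute: "cinner x y = 0 \<longleftrightarrow> cinner y (x::'a::complex_inner) = 0"
  by (metis cinner_commute complex_cnj_zero_iff)

lemma cinner_self_eq_0_iff: "cinner x x = 0 \<longleftrightarrow> x = (0::'a::complex_inner)"
  by (simp add: cinner_same)

lemma norm_add_orthogonal:
  fixes x y :: "'a::complex_inner"
  assumes "cinner x y = 0"
  shows "(norm (x + y))\<^sup>2 = (norm x)\<^sup>2 + (norm y)\<^sup>2"
proof -
  have "cinner (x + y) (x + y) = cinner x x + cinner y y"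
    using assms cinner_eq_0_commute[of x y] by (simp add: cinner_add_left cinner_add_right)
  then have "complex_of_real ((norm (x + y))\<^sup>2) = complex_of_real ((norm x)\<^sup>2 + (norm y)\<^sup>2)"
    by (simp add: cinner_same)
  then show ?thesis
    by (simp only: of_real_eq_iff)
qed

text \<open>Cauchy-Schwarz: \<open>c *\<^sub>C y\<close> is the orthogonal projection of
  \<open>x\<close> onto the line through \<open>y\<close>, so Pythagoras bounds its norm by that of
  \<open>x\<close>.\<close>

lemma norm_cinner_le: "cmod (cinner x y) \<le> norm x * norm (y::'a::complex_inner)"
proof (cases "y = 0")
  case False
  define c where "c = cinner x y / complex_of_real ((norm y)\<^sup>2)"
  have "cinner (x - c *\<^sub>C y) y = 0"
    using False by (simp add: cinner_diff_left cinner_scaleC_left cinner_same c_def)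
  then have "cinner (x - c *\<^sub>C y) (c *\<^sub>C y) = 0"
    by (simp add: cinner_scaleC_right)
  from norm_add_orthogonal[OF this]
  have "(norm (c *\<^sub>C y))\<^sup>2 \<le> (norm x)\<^sup>2"
    by simp
  then have "cmod c * norm y \<le> norm x"
    using power2_le_imp_le norm_scaleC by (metis norm_ge_zero)
  moreover have "cmod c = cmod (cinner x y) / (norm y * norm y)"
    by (simp add: c_def norm_divide norm_mult power2_eq_square)
  ultimately show ?thesis
    using False by (simp add: field_simps)
qed simp

lemma bounded_linear_cinner_left: "bounded_linear (\<lambda>x::'a::complex_inner. cinner x y)"
proof (rule bounded_linear_intro[where K = "norm y"])
  show "cinner (r *\<^sub>R x) y = r *\<^sub>R cinner x y" for r and x :: 'a
    by (metis cinner_scaleC_left scaleC_of_real scaleR_conv_of_real)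
qed (simp_all add: cinner_add_left norm_cinner_le)

text \<open>Conjugate linearity in the second argument is still real linearity, which is all that
  \<open>bounded_linear\<close> asks for.\<close>

lemma bounded_linear_cinner_right: "bounded_linear (\<lambda>x::'a::complex_inner. cinner y x)"
proof -
  have "(\<lambda>x. cinner y x) = (\<lambda>x. cnj (cinner x y))"
    by (auto simp: cinner_commute[of y])
  then show ?thesis
    using bounded_linear_compose[OF bounded_linear_cnj bounded_linear_cinner_left] by metis
qed

lemma scaleR_scaleC: "r *\<^sub>R x = complex_of_real r *\<^sub>C (x::'a::complex_normed_vector)"
  by (simp add: scaleC_of_real)

lemma scaleC_minus_one: "(-1) *\<^sub>C x = - (x::'a::complex_vector)"
  by (metis cvec.scale_minus_left cvec.scale_one)

text \<open>The vectors orthogonal to \<open>x - y\<close> form a closed subspace; it contains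
  \<open>B\<close>, hence everything, in particular \<open>x - y\<close> itself.\<close>

lemma cspan_dense_eqI:
  fixes x y :: "'a::complex_inner"
  assumes "closure (cspan B) = UNIV" and "\<And>b. b \<in> B \<Longrightarrow> cinner x b = cinner y b"
  shows "x = y"
proof -
  have "cinner (x - y) b = 0" if "b \<in> cspan B" for b
    using that
    by (induction rule: cvec.span_induct_alt)
       (simp_all add: assms(2) cinner_add_right cinner_scaleC_right cinner_diff_left)
  then have "cspan B \<subseteq> {b. cinner (x - y) b = 0}"
    by auto
  moreover have "closed {b. cinner (x - y) b = 0}"
    by (intro closed_Collect_eq linear_continuous_on[OF bounded_linear_cinner_right]
        continuous_on_const)
  ultimately have "cinner (x - y) (x - y) = 0"
    using closure_minimal[of "cspan B" "{b. cinner (x - y) b = 0}"] assms(1) by auto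
  then show ?thesis
    by (simp add: cinner_self_eq_0_iff)
qed

section \<open>Orthonormal sets, Bessel's inequality and Gram-Schmidt\<close>

definition orthonormal :: "'a::complex_inner set \<Rightarrow> bool" where
  "orthonormal S \<longleftrightarrow> (\<forall>x\<in>S. \<forall>y\<in>S. cinner x y = (if x = y then 1 else 0))"

lemma orthonormalD: "orthonormal S \<Longrightarrow> x \<in> S \<Longrightarrow> y \<in> S \<Longrightarrow> cinner x y = (if x = y then 1 else 0)"
  by (auto simp: orthonormal_def)

lemma orthonormal_subset: "orthonormal S \<Longrightarrow> T \<subseteq> S \<Longrightarrow> orthonormal T"
  unfolding orthonormal_def by blast

lemma orthonormal_expand:
  assumes "finite S" "orthonormal S" "x \<in> cspan S"
  shows "(\<Sum>s\<in>S. cinner x s *\<^sub>C s) = x"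
  using assms(3)
proof (induction rule: cvec.span_induct_alt)
  case (step c b y)
  have "(\<Sum>s\<in>S. cinner b s *\<^sub>C s) = (\<Sum>s\<in>S. if s = b then s else 0)"
    using orthonormalD[OF assms(2)] step(1) by (intro sum.cong) auto
  also have "\<dots> = b"
    using assms(1) step(1) by simp
  finally have b: "c *\<^sub>C (\<Sum>s\<in>S. cinner b s *\<^sub>C s) = c *\<^sub>C b"
    by simp
  show ?case
    using step b
    by (simp add: cinner_add_left cinner_scaleC_left scaleC_add_left sum.distrib
        cvec.scale_sum_right scaleC_scaleC)
qed simp

lemma cinner_orthonormal_sums:
  assumes "finite S" "orthonormal (\<phi> ` S)" "inj_on \<phi> S"
  shows "cinner (\<Sum>s\<in>S. c s *\<^sub>C \<phi> s) (\<Sum>s\<in>S. d s *\<^sub>C \<phi> s) = (\<Sum>s\<in>S. c s * cnj (d s))"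
proof -
  have "cinner (\<Sum>s\<in>S. c s *\<^sub>C \<phi> s) (\<Sum>s\<in>S. d s *\<^sub>C \<phi> s) =
    (\<Sum>s\<in>S. \<Sum>r\<in>S. if r = s then c s * cnj (d s) else 0)"
  proof -
    have "cnj (d r) * (c s * cinner (\<phi> s) (\<phi> r)) = (if r = s then c s * cnj (d s) else 0)"
      if "s \<in> S" "r \<in> S" for s r
      using orthonormalD[OF assms(2), of "\<phi> s" "\<phi> r"] assms(3) that by (auto simp: inj_on_eq_iff)
    then show ?thesis
      unfolding cinner_sum_left
      by (intro sum.cong refl)
        (simp add: cinner_sum_right cinner_scaleC_left cinner_scaleC_right sum_distrib_left)
  qed
  then show ?thesis
    using assms(1) by simp
qed

lemma norm_orthonormal_sum:
  assumes "finite S" "orthonormal (\<phi> ` S)" "inj_on \<phi> S"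
  shows "(norm (\<Sum>s\<in>S. c s *\<^sub>C \<phi> s))\<^sup>2 = (\<Sum>s\<in>S. (cmod (c s))\<^sup>2)"
proof -
  have "complex_of_real ((norm (\<Sum>s\<in>S. c s *\<^sub>C \<phi> s))\<^sup>2) =
      complex_of_real (\<Sum>s\<in>S. (cmod (c s))\<^sup>2)"
    using cinner_orthonormal_sums[OF assms, of c c]
    unfolding cinner_same of_real_sum complex_norm_square .
  then show ?thesis
    by (simp only: of_real_eq_iff)
qed

text \<open>Cauchy--Schwarz applied to a vector and its projection.\<close>

lemma norm_le_if_cinner_eq:
  fixes x p :: "'a::complex_inner"
  assumes "cinner x p = complex_of_real ((norm p)\<^sup>2)"
  shows "norm p \<le> norm x"
proof (cases "norm p = 0")
  case False
  have "norm p * norm p \<le> norm x * norm p"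
    using norm_cinner_le[of x p] assms by (simp add: norm_power power2_eq_square norm_mult)
  then show ?thesis
    using False by simp
qed simp

lemma bessel:
  assumes "finite S" "orthonormal S"
  shows "(\<Sum>s\<in>S. (cmod (cinner x s))\<^sup>2) \<le> (norm x)\<^sup>2"
proof -
  define p where "p = (\<Sum>s\<in>S. cinner x s *\<^sub>C s)"
  have p: "(norm p)\<^sup>2 = (\<Sum>s\<in>S. (cmod (cinner x s))\<^sup>2)"
    unfolding p_def using norm_orthonormal_sum[of S "\<lambda>s. s"] assms by simp
  have "cinner x p = complex_of_real ((norm p)\<^sup>2)"
    unfolding p of_real_sum complex_norm_square
    by (simp add: p_def cinner_sum_right cinner_scaleC_right mult.commute)
  from norm_le_if_cinner_eq[OF this] show ?thesis
    using p by (metis norm_ge_zero power_mono)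
qed

lemma orthonormal_insert_normalized:
  fixes v :: "'a::complex_inner"
  assumes "finite A" "orthonormal A" "v \<notin> cspan A"
  obtains u where "u \<notin> cspan A" "orthonormal (insert u A)" "v \<in> cspan (insert u A)"
    "u \<in> cspan (insert v A)"
proof -
  define p where "p = (\<Sum>s\<in>A. cinner v s *\<^sub>C s)"
  define w where "w = v - p"
  define u where "u = complex_of_real (inverse (norm w)) *\<^sub>C w"
  have p: "p \<in> cspan A"
    unfolding p_def by (intro cvec.span_sum cvec.span_scale cvec.span_base)
  have w0: "w \<noteq> 0"
    using assms(3) p by (auto simp: w_def)
  have wu: "w = complex_of_real (norm w) *\<^sub>C u"
    using w0 by (simp add: u_def scaleC_scaleC scaleC_one)
  have v: "v = p + complex_of_real (norm w) *\<^sub>C u"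
    using wu by (simp add: w_def)
  have orth: "cinner u s = 0" if "s \<in> A" for s
  proof -
    have "cinner p s = (\<Sum>r\<in>A. if r = s then cinner v s else 0)"
      unfolding p_def cinner_sum_left cinner_scaleC_left
      using orthonormalD[OF assms(2)] that by (intro sum.cong) auto
    then have "cinner w s = 0"
      using assms(1) that by (simp add: w_def cinner_diff_left)
    then show ?thesis
      by (simp add: u_def cinner_scaleC_left)
  qed
  have nu: "cinner u u = 1"
    using w0 by (simp add: cinner_same u_def norm_scaleC norm_inverse)
  show thesis
  proof
    show "u \<notin> cspan A"
    proof
      assume "u \<in> cspan A"
      then have "v \<in> cspan A"
        unfolding v using p by (intro cvec.span_add cvec.span_scale)
      then show False
        using assms(3) by simp
    qed
    show "orthonormal (insert u A)"
      using assms(2) orth nu cinner_eq_0_commute[of u] unfolding orthonormal_def by fastforce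
    have "p \<in> cspan (insert u A)"
      using p cvec.span_mono[of A "insert u A"] by auto
    then show "v \<in> cspan (insert u A)"
      unfolding v by (intro cvec.span_add cvec.span_scale) (auto intro: cvec.span_base)
    have "p \<in> cspan (insert v A)"
      using p cvec.span_mono[of A "insert v A"] by auto
    then show "u \<in> cspan (insert v A)"
      unfolding u_def w_def by (intro cvec.span_diff cvec.span_scale) (auto intro: cvec.span_base)
  qed
qed

text \<open>Both inclusions matter later: \<open>F \<subseteq> cspan A\<close> makes the projection
  onto the span of \<open>A\<close> fix the vectors of \<open>F\<close>, and
  \<open>A \<subseteq> cspan F\<close> expresses the basis vectors through those of
  \<open>F\<close>.\<close>

lemma gram_schmidt:
  fixes F :: "'a::complex_inner set"
  assumes "finite F"
  obtains A where "finite A" "orthonormal A" "F \<subseteq> cspan A" "A \<subseteq> cspan F"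
proof -
  have "\<exists>A. finite A \<and> orthonormal A \<and> F \<subseteq> cspan A \<and> A \<subseteq> cspan F"
    using assms
  proof (induction F)
    case empty
    show ?case
      by (intro exI[of _ "{}"]) (auto simp: orthonormal_def)
  next
    case (insert v F)
    then obtain A where A: "finite A" "orthonormal A" "F \<subseteq> cspan A" "A \<subseteq> cspan F"
      by auto
    have AF: "A \<subseteq> cspan (insert v F)"
      using A(4) cvec.span_mono[of F "insert v F"] by auto
    show ?case
    proof (cases "v \<in> cspan A")
      case True
      then show ?thesis
        using A AF by (intro exI[of _ A]) auto
    next
      case False
      obtain u where u: "u \<notin> cspan A" "orthonormal (insert u A)" "v \<in> cspan (insert u A)"
        "u \<in> cspan (insert v A)"
        using orthonormal_insert_normalized[OF A(1,2) False] .
      have "insert v A \<subseteq> cspan (insert v F)"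
        using AF by (auto intro: cvec.span_base)
      then have "u \<in> cspan (insert v F)"
        using u(4) cvec.span_minimal[OF _ cvec.subspace_span] by blast
      moreover have "F \<subseteq> cspan (insert u A)"
        using A(3) cvec.span_mono[of A "insert u A"] by auto
      ultimately show ?thesis
        using u A AF by (intro exI[of _ "insert u A"]) auto
    qed
  qed
  then show thesis
    using that by blast
qed

text \<open>This is where infinite dimension enters: no finite set spans, so there is always a
  vector left to normalize. The choice \<open>A = {}\<close>, \<open>n = 1\<close> provides a unit
  vector.\<close>

lemma orthonormal_extend:
  fixes A :: "'a::complex_inner set"
  assumes inf: "\<not> (\<exists>B :: 'a set. finite B \<and> cspan B = UNIV)"
    and A: "finite A" "orthonormal A"
  shows "\<exists>E. finite E \<and> card E = n \<and> A \<inter> E = {} \<and> orthonormal (A \<union> E)"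
proof (induction n)
  case 0
  show ?case
    using A by (intro exI[of _ "{}"]) auto
next
  case (Suc n)
  then obtain E where E: "finite E" "card E = n" "A \<inter> E = {}" "orthonormal (A \<union> E)"
    by auto
  have fin: "finite (A \<union> E)"
    using A E by auto
  then obtain v where v: "v \<notin> cspan (A \<union> E)"
    using inf by blast
  obtain u where u: "u \<notin> cspan (A \<union> E)" "orthonormal (insert u (A \<union> E))"
    using orthonormal_insert_normalized[OF fin E(4) v] by metis
  then have "u \<notin> A \<union> E"
    using cvec.span_base[of u "A \<union> E"] by argo
  then show ?case
    using E u by (intro exI[of _ "insert u E"]) auto
qed


section \<open>Operators of finite rank\<close>

lemma bops_D: "a \<in> bops \<Longrightarrow> blinfun_apply a (c *\<^sub>C x) = c *\<^sub>C blinfun_apply a x"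
  by (simp add: bops_def)

lemma blinfun_apply_scaleC: "blinfun_apply (c *\<^sub>C a) x = c *\<^sub>C blinfun_apply a x"
  by (simp add: scaleC_blinfun.rep_eq)

lemma bops_0 [simp]: "0 \<in> bops"
  by (simp add: bops_def cvec.scale_zero_right)

lemma bops_id [simp]: "id_blinfun \<in> bops"
  by (simp add: bops_def)

lemma bops_add: "a \<in> bops \<Longrightarrow> b \<in> bops \<Longrightarrow> a + b \<in> bops"
  by (simp add: bops_def blinfun.add_left scaleC_add_right)

lemma bops_scaleC: "a \<in> bops \<Longrightarrow> c *\<^sub>C a \<in> bops"
  by (simp add: bops_def blinfun_apply_scaleC scaleC_scaleC mult.commute)

lemma bops_compose: "a \<in> bops \<Longrightarrow> b \<in> bops \<Longrightarrow> a o\<^sub>L b \<in> bops"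
  by (simp add: bops_def)

lemma bops_sum: "(\<And>i. i \<in> S \<Longrightarrow> a i \<in> bops) \<Longrightarrow> (\<Sum>i\<in>S. a i) \<in> bops"
  by (induction S rule: infinite_finite_induct) (auto intro: bops_add)

definition rank1 :: "'l::complex_inner \<Rightarrow> 'l \<Rightarrow> 'l \<Rightarrow>\<^sub>L 'l" where
  "rank1 \<xi> \<eta> = Blinfun (\<lambda>x. cinner x \<eta> *\<^sub>C \<xi>)"

lemma rank1_apply [simp]: "blinfun_apply (rank1 \<xi> \<eta>) x = cinner x \<eta> *\<^sub>C \<xi>"
proof -
  have "bounded_linear (\<lambda>x. cinner x \<eta> *\<^sub>C \<xi>)"
  proof (rule bounded_linear_intro[where K = "norm \<eta> * norm \<xi>"])
    show "cinner (x + y) \<eta> *\<^sub>C \<xi> = cinner x \<eta> *\<^sub>C \<xi> + cinner y \<eta> *\<^sub>C \<xi>" for x y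
      by (simp add: cinner_add_left scaleC_add_left)
    show "cinner (r *\<^sub>R x) \<eta> *\<^sub>C \<xi> = r *\<^sub>R cinner x \<eta> *\<^sub>C \<xi>" for r x
      by (simp add: scaleR_scaleC cinner_scaleC_left scaleC_scaleC)
    show "norm (cinner x \<eta> *\<^sub>C \<xi>) \<le> norm x * (norm \<eta> * norm \<xi>)" for x
      unfolding norm_scaleC mult.assoc[symmetric]
      by (intro mult_right_mono norm_cinner_le) simp
  qed
  then show ?thesis
    by (simp add: rank1_def bounded_linear_Blinfun_apply)
qed

lemma rank1_bops [simp]: "rank1 \<xi> \<eta> \<in> bops"
  by (simp add: bops_def cinner_scaleC_left scaleC_scaleC)

lemma rank1_add_left: "rank1 (\<xi> + \<xi>') \<eta> = rank1 \<xi> \<eta> + rank1 \<xi>' \<eta>"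
  by (rule blinfun_eqI) (simp add: blinfun.add_left scaleC_add_right)

lemma rank1_scaleC_left: "rank1 (c *\<^sub>C \<xi>) \<eta> = c *\<^sub>C rank1 \<xi> \<eta>"
  by (rule blinfun_eqI) (simp add: blinfun_apply_scaleC scaleC_scaleC mult.commute)

lemma compose_rank1: "a \<in> bops \<Longrightarrow> a o\<^sub>L rank1 \<xi> \<eta> = rank1 (blinfun_apply a \<xi>) \<eta>"
  by (rule blinfun_eqI) (simp add: bops_D)

section \<open>Partial isometries and projections of finite rank\<close>

text \<open>The partial isometry that maps \<open>e\<close> to \<open>\<phi> e\<close> for \<open>e \<in> E\<close> and vanishes on its orthogonal complement, for orthonormal \<open>E\<close>.\<close>

definition pisom :: "'l::complex_inner set \<Rightarrow> ('l \<Rightarrow> 'l) \<Rightarrow> 'l \<Rightarrow>\<^sub>L 'l" where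
  "pisom E \<phi> = (\<Sum>e\<in>E. rank1 (\<phi> e) e)"

lemma pisom_apply: "blinfun_apply (pisom E \<phi>) x = (\<Sum>e\<in>E. cinner x e *\<^sub>C \<phi> e)"
  by (simp add: pisom_def blinfun.sum_left)

lemma pisom_bops [simp]: "pisom E \<phi> \<in> bops"
  by (simp add: pisom_def bops_sum)

lemma norm_pisom_le:
  assumes "finite E" "orthonormal E" "orthonormal (\<phi> ` E)" "inj_on \<phi> E"
  shows "norm (pisom E \<phi>) \<le> 1"
proof (rule norm_blinfun_bound)
  fix x
  have "(norm (blinfun_apply (pisom E \<phi>) x))\<^sup>2 \<le> (norm x)\<^sup>2"
    unfolding pisom_apply norm_orthonormal_sum[OF assms(1,3,4)] by (rule bessel[OF assms(1,2)])
  then show "norm (blinfun_apply (pisom E \<phi>) x) \<le> 1 * norm x"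
    using power2_le_imp_le by simp
qed simp

abbreviation proj :: "'l::complex_inner set \<Rightarrow> 'l \<Rightarrow>\<^sub>L 'l" where
  "proj E \<equiv> pisom E (\<lambda>x. x)"

lemma proj_apply_cspan: "finite E \<Longrightarrow> orthonormal E \<Longrightarrow> x \<in> cspan E \<Longrightarrow> blinfun_apply (proj E) x = x"
  by (simp add: pisom_apply orthonormal_expand)

lemma pisom_in_cspan: "blinfun_apply (pisom E \<phi>) x \<in> cspan (\<phi> ` E)"
  unfolding pisom_apply by (intro cvec.span_sum cvec.span_scale cvec.span_base) auto

lemma pisom_eq_0:
  assumes "x \<in> cspan A" "\<And>e a. e \<in> E \<Longrightarrow> a \<in> A \<Longrightarrow> cinner a e = 0"
  shows "blinfun_apply (pisom E \<phi>) x = 0"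
proof -
  have "cinner x e = 0" if "e \<in> E" for e
    using assms(1) by (induction rule: cvec.span_induct_alt)
      (simp_all add: cinner_add_left cinner_scaleC_left assms(2) that)
  then show ?thesis
    by (simp add: pisom_apply)
qed

lemma projection_proj:
  assumes "finite E" "orthonormal E"
  shows "projection (proj E)"
  unfolding projection_def
proof (intro conjI allI)
  show "proj E o\<^sub>L proj E = proj E"
    using pisom_in_cspan[of E "\<lambda>x. x"]
    by (intro blinfun_eqI) (simp add: proj_apply_cspan[OF assms])
  show "cinner (blinfun_apply (proj E) x) y = cinner x (blinfun_apply (proj E) y)" for x y
    by (simp add: pisom_apply cinner_sum_left cinner_sum_right cinner_scaleC_left
        cinner_scaleC_right cinner_commute[of y] mult.commute)
qed simp

text \<open>The left factor is the adjoint of \<open>pisom E \<phi>\<close>: the adjoint of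
  \<open>rank1 (\<phi> e) e\<close> is \<open>rank1 e (\<phi> e)\<close>.\<close>

lemma pisom_inv:
  assumes "finite E" "orthonormal (\<phi> ` E)" "inj_on \<phi> E"
  shows "pisom (\<phi> ` E) (inv_into E \<phi>) o\<^sub>L pisom E \<phi> = proj E"
proof (rule blinfun_eqI)
  fix x
  have "blinfun_apply (pisom (\<phi> ` E) (inv_into E \<phi>) o\<^sub>L pisom E \<phi>) x =
    (\<Sum>e\<in>E. (\<Sum>r\<in>E. if r = e then cinner x e else 0) *\<^sub>C e)"
    unfolding blinfun_apply_blinfun_compose pisom_apply sum.reindex[OF assms(3)] comp_def
      cinner_sum_left cinner_scaleC_left
    using orthonormalD[OF assms(2)] assms(3)
    by (intro sum.cong arg_cong2[where f = scaleC] refl) (auto simp: inj_on_eq_iff)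
  then show "blinfun_apply (pisom (\<phi> ` E) (inv_into E \<phi>) o\<^sub>L pisom E \<phi>) x = blinfun_apply (proj E) x"
    using assms(1) by (simp add: pisom_apply)
qed


section \<open>Hilbert tensor products\<close>

text \<open>Extension by continuity of a bounded map that is given by its graph \<open>R\<close>.
  For slices and ampliations \<open>R\<close> is a characterizing identity, which is visibly
  single-valued and stable under differences and limits; on the dense part only the existence of a
  bounded value has to be shown.\<close>

lemma closure_extend_relation:
  fixes R :: "'a::real_normed_vector \<Rightarrow> 'b::{real_normed_vector, complete_space} \<Rightarrow> bool"
  assumes total: "\<And>v. v \<in> D \<Longrightarrow> \<exists>w. R v w \<and> norm w \<le> K * norm v"
    and unique: "\<And>v w w'. R v w \<Longrightarrow> R v w' \<Longrightarrow> w = w'"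
    and D: "\<And>v v'. v \<in> D \<Longrightarrow> v' \<in> D \<Longrightarrow> v - v' \<in> D"
    and R: "\<And>v v' w w'. R v w \<Longrightarrow> R v' w' \<Longrightarrow> R (v - v') (w - w')"
    and limit: "\<And>v w x y. (\<And>n::nat. R (v n) (w n)) \<Longrightarrow> v \<longlonglongrightarrow> x \<Longrightarrow> w \<longlonglongrightarrow> y \<Longrightarrow> R x y"
    and "0 \<le> K" "x \<in> closure D"
  shows "\<exists>y. R x y \<and> norm y \<le> K * norm x"
proof -
  obtain v where v: "\<And>n::nat. v n \<in> D" "v \<longlonglongrightarrow> x"
    using \<open>x \<in> closure D\<close> closure_sequential by metis
  obtain w where w: "\<And>n. R (v n) (w n)" "\<And>n. norm (w n) \<le> K * norm (v n)"
    using total[OF v(1)] by metis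
  \<comment> \<open>By uniqueness \<open>w i - w j\<close> is the bounded value that
    \<open>total\<close> provides for \<open>v i - v j\<close>, so \<open>w\<close> inherits the
    Cauchy property.\<close>
  have bound: "norm (w i - w j) \<le> K * norm (v i - v j)" for i j
    using total[OF D[OF v(1) v(1)], of i j] unique[OF R[OF w(1) w(1)], of i j] by metis
  have "Cauchy v"
    using v(2) LIMSEQ_imp_Cauchy by blast
  have "Cauchy w"
  proof (rule metric_CauchyI)
    fix e :: real
    assume "0 < e"
    \<comment> \<open>\<open>K + 1\<close> instead of \<open>K\<close> keeps the denominator
      positive when \<open>K = 0\<close>.\<close>
    then obtain M where M: "\<And>i j. i \<ge> M \<Longrightarrow> j \<ge> M \<Longrightarrow> dist (v i) (v j) < e / (K + 1)"
      using metric_CauchyD[OF \<open>Cauchy v\<close>, of "e / (K + 1)"] \<open>0 \<le> K\<close> by auto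
    have "dist (w i) (w j) < e" if "i \<ge> M" "j \<ge> M" for i j
    proof -
      have "norm (w i - w j) \<le> (K + 1) * norm (v i - v j)"
        using bound[of i j] norm_ge_zero[of "v i - v j"] by (simp only: distrib_right mult_1)
      also have "\<dots> < (K + 1) * (e / (K + 1))"
        using M[OF that] \<open>0 \<le> K\<close> by (intro mult_strict_left_mono) (auto simp: dist_norm)
      finally show ?thesis
        using \<open>0 \<le> K\<close> by (simp add: dist_norm)
    qed
    then show "\<exists>M. \<forall>m\<ge>M. \<forall>n\<ge>M. dist (w m) (w n) < e"
      by blast
  qed
  then obtain y where y: "w \<longlonglongrightarrow> y"
    using Cauchy_convergent convergent_def by blast
  have "norm y \<le> K * norm x"
    using w(2) by (intro LIMSEQ_le[OF tendsto_norm[OF y] tendsto_mult[OF tendsto_const tendsto_norm[OF v(2)]]])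
      auto
  then show ?thesis
    using limit[OF w(1) v(2) y] by blast
qed

locale htensor =
  fixes t :: "'l::chilbert_space \<Rightarrow> 'h::chilbert_space \<Rightarrow> 't::chilbert_space"
  assumes htensor: "hilbert_tensor t"
begin

lemma t_add_left: "t (x + x') h = t x h + t x' h"
  and t_add_right: "t x (h + h') = t x h + t x h'"
  and t_scaleC_left: "t (c *\<^sub>C x) h = c *\<^sub>C t x h"
  and t_scaleC_right: "t x (c *\<^sub>C h) = c *\<^sub>C t x h"
  and cinner_t: "cinner (t x h) (t x' h') = cinner x x' * cinner h h'"
  and t_dense: "closure (cspan (range (\<lambda>(x, h). t x h))) = UNIV"
  using htensor unfolding hilbert_tensor_def by blast+

lemma t_zero_left [simp]: "t 0 h = 0" and t_zero_right [simp]: "t x 0 = 0"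
  using t_add_left[of 0 0 h] t_add_right[of x 0 0] by simp_all

lemma t_sum_right: "t x (\<Sum>i\<in>S. f i) = (\<Sum>i\<in>S. t x (f i))"
  by (induction S rule: infinite_finite_induct) (auto simp: t_add_right)

lemma norm_t: "norm (t x h) = norm x * norm h"
proof -
  have "complex_of_real ((norm (t x h))\<^sup>2) = complex_of_real ((norm x * norm h)\<^sup>2)"
    using cinner_t[of x h x h] by (simp add: cinner_same power_mult_distrib)
  then have "(norm (t x h))\<^sup>2 = (norm x * norm h)\<^sup>2"
    by (simp only: of_real_eq_iff)
  then show ?thesis
    by (simp add: power2_eq_iff_nonneg)
qed

lemma eq_if_cinner_t_eq: "(\<And>x h. cinner \<zeta> (t x h) = cinner \<eta> (t x h)) \<Longrightarrow> \<zeta> = \<eta>"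
  by (rule cspan_dense_eqI[OF t_dense]) auto

section \<open>Slices of tensors\<close>

text \<open>The operator \<open>1 \<otimes> \<langle>\<cdot>, h\<rangle>\<close> from the tensor product to the first factor.\<close>

definition slice :: "'h \<Rightarrow> 't \<Rightarrow> 'l" where
  "slice h \<zeta> = (THE \<xi>. \<forall>\<xi>'. cinner \<xi> \<xi>' = cinner \<zeta> (t \<xi>' h))"

lemma slice_unique:
  assumes "\<forall>\<xi>'. cinner \<xi> \<xi>' = cinner \<zeta> (t \<xi>' h)" "\<forall>\<xi>'. cinner \<eta> \<xi>' = cinner \<zeta> (t \<xi>' h)"
  shows "\<xi> = \<eta>"
proof -
  have "cinner (\<xi> - \<eta>) (\<xi> - \<eta>) = 0"
    using assms by (simp add: cinner_diff_left)
  then show ?thesis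
    by (simp add: cinner_self_eq_0_iff)
qed

lemma slice_exists:
  "\<exists>\<xi>. (\<forall>\<xi>'. cinner \<xi> \<xi>' = cinner \<zeta> (t \<xi>' h)) \<and> norm \<xi> \<le> norm h * norm \<zeta>"
proof (rule closure_extend_relation)
  let ?R = "\<lambda>\<zeta> \<xi>. \<forall>\<xi>'. cinner \<xi> \<xi>' = cinner \<zeta> (t \<xi>' h)"
  show "\<zeta> \<in> closure (cspan (range (\<lambda>(x, h). t x h)))"
    by (simp add: t_dense)
  fix v
  assume "v \<in> cspan (range (\<lambda>(x, h). t x h))"
  then have "\<exists>\<xi>. ?R v \<xi>"
  proof (induction rule: cvec.span_induct_alt)
    case base
    show ?case
      by (intro exI[of _ 0]) simp
  next
    case (step c b y)
    then obtain x g \<xi> where b: "b = t x g" and "?R y \<xi>"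
      by auto
    then show ?case
      by (intro exI[of _ "c *\<^sub>C cinner g h *\<^sub>C x + \<xi>"])
        (simp add: cinner_add_left cinner_scaleC_left cinner_t)
  qed
  then obtain \<xi> where \<xi>: "?R v \<xi>" ..
  \<comment> \<open>The defining identity is tested at \<open>\<xi>' = \<xi>\<close>, where its left
    side is the squared norm, and Cauchy-Schwarz bounds its right side.\<close>
  have "norm \<xi> * norm \<xi> \<le> (norm h * norm v) * norm \<xi>"
    using norm_cinner_le[of v "t \<xi> h"] \<xi>[rule_format, of \<xi>, symmetric]
    by (simp add: cinner_same norm_t power2_eq_square norm_mult mult_ac)
  then have "norm \<xi> \<le> norm h * norm v"
    by (cases "norm \<xi> = 0") auto
  with \<xi> show "\<exists>\<xi>. ?R v \<xi> \<and> norm \<xi> \<le> norm h * norm v"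
    by blast
next
  fix v w x y
  assume lim: "\<And>n::nat. \<forall>\<xi>'. cinner (w n) \<xi>' = cinner (v n) (t \<xi>' h)" "v \<longlonglongrightarrow> x" "w \<longlonglongrightarrow> y"
  show "\<forall>\<xi>'. cinner y \<xi>' = cinner x (t \<xi>' h)"
  proof
    fix \<xi>'
    have "(\<lambda>n. cinner (w n) \<xi>') \<longlonglongrightarrow> cinner y \<xi>'"
      using lim(3) by (rule bounded_linear.tendsto[OF bounded_linear_cinner_left])
    moreover have "(\<lambda>n. cinner (v n) (t \<xi>' h)) \<longlonglongrightarrow> cinner x (t \<xi>' h)"
      using lim(2) by (rule bounded_linear.tendsto[OF bounded_linear_cinner_left])
    ultimately show "cinner y \<xi>' = cinner x (t \<xi>' h)"
      using lim(1) LIMSEQ_unique by auto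
  qed
qed (auto simp: cinner_diff_left cvec.span_diff intro: slice_unique)

lemma cinner_slice: "cinner (slice h \<zeta>) \<xi> = cinner \<zeta> (t \<xi> h)"
  and norm_slice_le: "norm (slice h \<zeta>) \<le> norm h * norm \<zeta>"
proof -
  obtain \<xi>' where \<xi>': "\<forall>\<xi>. cinner \<xi>' \<xi> = cinner \<zeta> (t \<xi> h)" "norm \<xi>' \<le> norm h * norm \<zeta>"
    using slice_exists by blast
  then have "slice h \<zeta> = \<xi>'"
    unfolding slice_def by (intro the_equality slice_unique)
  then show "cinner (slice h \<zeta>) \<xi> = cinner \<zeta> (t \<xi> h)" "norm (slice h \<zeta>) \<le> norm h * norm \<zeta>"
    using \<xi>' by simp_all
qed

lemma slice_eqI: "(\<And>\<xi>'. cinner \<xi> \<xi>' = cinner \<zeta> (t \<xi>' h)) \<Longrightarrow> slice h \<zeta> = \<xi>"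
  using slice_unique cinner_slice by blast

text \<open>Slices encode the inner products with all elementary tensors, whose span is dense.
  Identities in the completed tensor product thereby reduce to identities in the first
  factor.\<close>

lemma eq_if_slice_eq: "(\<And>h. slice h \<zeta> = slice h \<eta>) \<Longrightarrow> \<zeta> = \<eta>"
  by (rule eq_if_cinner_t_eq) (metis cinner_slice)

lemma slice_add: "slice h (\<zeta> + \<eta>) = slice h \<zeta> + slice h \<eta>"
  by (rule slice_eqI) (simp add: cinner_add_left cinner_slice)

lemma slice_scaleC: "slice h (c *\<^sub>C \<zeta>) = c *\<^sub>C slice h \<zeta>"
  by (rule slice_eqI) (simp add: cinner_scaleC_left cinner_slice)

lemma slice_zero [simp]: "slice h 0 = 0"
  by (rule slice_eqI) simp

lemma slice_diff: "slice h (\<zeta> - \<eta>) = slice h \<zeta> - slice h \<eta>"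
  by (rule slice_eqI) (simp add: cinner_diff_left cinner_slice)

lemma slice_sum: "slice h (\<Sum>i\<in>S. f i) = (\<Sum>i\<in>S. slice h (f i))"
  by (induction S rule: infinite_finite_induct) (auto simp: slice_add)

lemma slice_t: "slice h (t x g) = cinner g h *\<^sub>C x"
  by (rule slice_eqI) (simp add: cinner_scaleC_left cinner_t mult.commute)

lemma tendsto_slice: "v \<longlonglongrightarrow> x \<Longrightarrow> (\<lambda>n. slice h (v n)) \<longlonglongrightarrow> slice h x"
  by (rule bounded_linear.tendsto, rule bounded_linear_intro[where K = "norm h"])
    (auto simp: slice_add slice_scaleC scaleR_scaleC norm_slice_le mult.commute)

section \<open>Truncation of the second leg\<close>

text \<open>For orthonormal \<open>S\<close>, the orthogonal projection onto the tensors whose second leg is in the span of \<open>S\<close>.\<close>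

definition trunc :: "'h set \<Rightarrow> 't \<Rightarrow> 't" where
  "trunc S \<zeta> = (\<Sum>h\<in>S. t (slice h \<zeta>) h)"

text \<open>For finite orthonormal \<open>S\<close> this is the algebraic tensor product of the
  first factor with the span of \<open>S\<close>. Being a fixed point of \<open>trunc S\<close>
  gives the decomposition over \<open>S\<close> at once.\<close>

definition trunc_space :: "'h set \<Rightarrow> 't set" where
  "trunc_space S = {\<zeta>. trunc S \<zeta> = \<zeta>}"

lemma slice_trunc: "slice g (trunc S \<zeta>) = (\<Sum>h\<in>S. cinner h g *\<^sub>C slice h \<zeta>)"
  by (simp add: trunc_def slice_sum slice_t)

lemma slice_trunc_mem:
  assumes "finite S" "orthonormal S" "h \<in> S"
  shows "slice h (trunc S \<zeta>) = slice h \<zeta>"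
proof -
  have "slice h (trunc S \<zeta>) = (\<Sum>g\<in>S. if g = h then slice h \<zeta> else 0)"
    unfolding slice_trunc using orthonormalD[OF assms(2) _ assms(3)]
    by (intro sum.cong) (auto simp: scaleC_one)
  then show ?thesis
    using assms by simp
qed

lemma trunc_in_trunc_space: "finite S \<Longrightarrow> orthonormal S \<Longrightarrow> trunc S \<zeta> \<in> trunc_space S"
  unfolding trunc_space_def mem_Collect_eq trunc_def[of S "trunc S \<zeta>"]
  by (simp add: slice_trunc_mem) (simp add: trunc_def)

lemma trunc_space_eq: "\<zeta> \<in> trunc_space S \<Longrightarrow> \<zeta> = (\<Sum>h\<in>S. t (slice h \<zeta>) h)"
  by (simp add: trunc_space_def trunc_def)

lemma subspace_trunc_space: "csubspace (trunc_space S)"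
  by (auto simp: cvec.subspace_def trunc_space_def trunc_def slice_add slice_scaleC t_add_left
      t_scaleC_left sum.distrib simp flip: cvec.scale_sum_right)

lemma cinner_trunc: "cinner \<zeta> (trunc S \<eta>) = (\<Sum>h\<in>S. cinner (slice h \<zeta>) (slice h \<eta>))"
  by (simp add: trunc_def cinner_sum_right cinner_slice)

lemma norm_sum_t:
  assumes "finite S" "orthonormal S"
  shows "(norm (\<Sum>h\<in>S. t (\<xi> h) h))\<^sup>2 = (\<Sum>h\<in>S. (norm (\<xi> h))\<^sup>2)"
proof -
  have "cinner (\<Sum>h\<in>S. t (\<xi> h) h) (\<Sum>h\<in>S. t (\<xi> h) h) =
    (\<Sum>h\<in>S. \<Sum>g\<in>S. if g = h then cinner (\<xi> h) (\<xi> h) else 0)"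
    unfolding cinner_sum_left
    by (intro sum.cong refl, unfold cinner_sum_right, intro sum.cong refl)
      (auto simp: cinner_t orthonormalD[OF assms(2)])
  then have "complex_of_real ((norm (\<Sum>h\<in>S. t (\<xi> h) h))\<^sup>2) = complex_of_real (\<Sum>h\<in>S. (norm (\<xi> h))\<^sup>2)"
    using assms(1) by (simp add: cinner_same)
  then show ?thesis
    by (simp only: of_real_eq_iff)
qed

lemma norm_trunc_le:
  assumes "finite S" "orthonormal S"
  shows "norm (trunc S \<zeta>) \<le> norm \<zeta>"
proof (rule norm_le_if_cinner_eq)
  show "cinner \<zeta> (trunc S \<zeta>) = complex_of_real ((norm (trunc S \<zeta>))\<^sup>2)"
    unfolding cinner_trunc unfolding trunc_def norm_sum_t[OF assms] by (simp add: cinner_same)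
qed

lemma alg_hilbert_tensor_subspace: "csubspace (alg_hilbert_tensor t)"
  by (simp add: alg_hilbert_tensor_def cvec.subspace_span)

lemma t_in_alg: "t x h \<in> alg_hilbert_tensor t"
  unfolding alg_hilbert_tensor_def by (rule cvec.span_base) auto

lemma trunc_space_subset_alg: "trunc_space S \<subseteq> alg_hilbert_tensor t"
proof
  fix \<zeta>
  assume "\<zeta> \<in> trunc_space S"
  then have "\<zeta> = (\<Sum>h\<in>S. t (slice h \<zeta>) h)"
    by (rule trunc_space_eq)
  moreover have "(\<Sum>h\<in>S. t (slice h \<zeta>) h) \<in> alg_hilbert_tensor t"
    by (intro cvec.subspace_sum alg_hilbert_tensor_subspace t_in_alg)
  ultimately show "\<zeta> \<in> alg_hilbert_tensor t"
    by simp
qed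

text \<open>\<open>F\<close> collects second legs of the tensor. A finite set is produced first, and
  not an orthonormal one, because the sets of several tensors can be united before they are
  orthonormalized.\<close>

lemma alg_in_trunc_space:
  assumes "\<zeta> \<in> alg_hilbert_tensor t"
  shows "\<exists>F. finite F \<and> (\<forall>S. finite S \<longrightarrow> orthonormal S \<longrightarrow> F \<subseteq> cspan S \<longrightarrow> \<zeta> \<in> trunc_space S)"
  using assms unfolding alg_hilbert_tensor_def
proof (induction rule: cvec.span_induct_alt)
  case base
  show ?case
    using cvec.subspace_0[OF subspace_trunc_space] by blast
next
  case (step c b \<eta>)
  then obtain F x h where F: "finite F"
    "\<And>S. finite S \<Longrightarrow> orthonormal S \<Longrightarrow> F \<subseteq> cspan S \<Longrightarrow> \<eta> \<in> trunc_space S" and b: "b = t x h"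
    by auto
  have "t x h \<in> trunc_space S" if "finite S" "orthonormal S" "h \<in> cspan S" for S
  proof -
    have "t x h = t x (\<Sum>g\<in>S. cinner h g *\<^sub>C g)"
      by (simp add: orthonormal_expand[OF that])
    then show ?thesis
      unfolding trunc_space_def mem_Collect_eq trunc_def slice_t
      by (simp add: t_sum_right t_scaleC_left t_scaleC_right)
  qed
  then show ?case
    using F unfolding b
    by (intro exI[of _ "insert h F"])
      (auto intro!: cvec.subspace_add[OF subspace_trunc_space] cvec.subspace_scale[OF subspace_trunc_space])
qed

lemma finite_alg_in_trunc_space:
  assumes "finite W" "W \<subseteq> alg_hilbert_tensor t"
  obtains S where "finite S" "orthonormal S" "W \<subseteq> trunc_space S"
proof -
  have "\<forall>\<zeta>\<in>W. \<exists>F. finite F \<and>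
      (\<forall>S. finite S \<longrightarrow> orthonormal S \<longrightarrow> F \<subseteq> cspan S \<longrightarrow> \<zeta> \<in> trunc_space S)"
    using alg_in_trunc_space assms(2) by blast
  then obtain F where F: "\<And>\<zeta>. \<zeta> \<in> W \<Longrightarrow> finite (F \<zeta>)"
    "\<And>\<zeta> S. \<zeta> \<in> W \<Longrightarrow> finite S \<Longrightarrow> orthonormal S \<Longrightarrow> F \<zeta> \<subseteq> cspan S \<Longrightarrow> \<zeta> \<in> trunc_space S"
    by metis
  have "finite (\<Union>\<zeta>\<in>W. F \<zeta>)"
    using F(1) assms(1) by blast
  then obtain S where S: "finite S" "orthonormal S" "(\<Union>\<zeta>\<in>W. F \<zeta>) \<subseteq> cspan S"
    by (rule gram_schmidt)
  have "W \<subseteq> trunc_space S"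
    using F(2) S by (meson SUP_le_iff subsetI)
  then show thesis
    using that S by blast
qed

section \<open>The action of the operators on the tensor product\<close>

lemma ampliation_exists:
  assumes a: "a \<in> bops"
  shows "\<exists>\<eta>. (\<forall>h. slice h \<eta> = blinfun_apply a (slice h \<zeta>)) \<and> norm \<eta> \<le> norm a * norm \<zeta>"
proof (rule closure_extend_relation)
  let ?R = "\<lambda>\<zeta> \<eta>. \<forall>h. slice h \<eta> = blinfun_apply a (slice h \<zeta>)"
  show "\<zeta> \<in> closure (alg_hilbert_tensor t)"
    by (simp add: t_dense alg_hilbert_tensor_def)
  fix v
  assume "v \<in> alg_hilbert_tensor t"
  then obtain S where S: "finite S" "orthonormal S" "v \<in> trunc_space S"
    using finite_alg_in_trunc_space[of "{v}"] by auto
  have v: "v = trunc S v"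
    using S(3) by (simp add: trunc_space_def)
  define \<eta> where "\<eta> = (\<Sum>h\<in>S. t (blinfun_apply a (slice h v)) h)"
  have "slice h \<eta> = blinfun_apply a (slice h v)" for h
    using arg_cong[OF v, of "\<lambda>v. blinfun_apply a (slice h v)"]
    by (simp add: \<eta>_def slice_trunc slice_sum slice_t blinfun.sum_right bops_D[OF a])
  \<comment> \<open>As \<open>S\<close> is orthonormal, the squared norms of \<open>\<eta>\<close>
    and \<open>v\<close> are the sums of the squared norms of their legs, and \<open>a\<close> acts
    on each leg separately.\<close>
  moreover have "norm \<eta> \<le> norm a * norm v"
  proof (rule power2_le_imp_le)
    have "(norm \<eta>)\<^sup>2 = (\<Sum>h\<in>S. (norm (blinfun_apply a (slice h v)))\<^sup>2)"
      unfolding \<eta>_def by (rule norm_sum_t[OF S(1,2)])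
    also have "\<dots> \<le> (\<Sum>h\<in>S. (norm a * norm (slice h v))\<^sup>2)"
      by (intro sum_mono power_mono norm_blinfun) simp
    also have "\<dots> = (norm a)\<^sup>2 * (norm (trunc S v))\<^sup>2"
      unfolding trunc_def norm_sum_t[OF S(1,2)] by (simp add: power_mult_distrib sum_distrib_left)
    finally show "(norm \<eta>)\<^sup>2 \<le> (norm a * norm v)\<^sup>2"
      using v by (simp add: power_mult_distrib)
  qed simp
  ultimately show "\<exists>\<eta>. ?R v \<eta> \<and> norm \<eta> \<le> norm a * norm v"
    by blast
next
  fix v w x y
  assume lim: "\<And>n::nat. \<forall>h. slice h (w n) = blinfun_apply a (slice h (v n))"
    "v \<longlonglongrightarrow> x" "w \<longlonglongrightarrow> y"
  show "\<forall>h. slice h y = blinfun_apply a (slice h x)"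
  proof
    fix h
    have "(\<lambda>n. slice h (w n)) \<longlonglongrightarrow> slice h y"
      using lim(3) by (rule tendsto_slice)
    moreover have "(\<lambda>n. blinfun_apply a (slice h (v n))) \<longlonglongrightarrow> blinfun_apply a (slice h x)"
      by (intro blinfun.tendsto tendsto_const tendsto_slice lim(2))
    ultimately show "slice h y = blinfun_apply a (slice h x)"
      using lim(1) LIMSEQ_unique by auto
  qed
qed (auto simp: slice_diff blinfun.diff_right intro: eq_if_slice_eq
  cvec.subspace_diff[OF alg_hilbert_tensor_subspace])

text \<open>Shows that the definite description in \<open>ampliation\<close> is met: the map built
  from slices satisfies it, and any other candidate agrees with that map on elementary tensors,
  hence on their span and by continuity everywhere.\<close>

lemma ampliation:
  assumes a: "a \<in> bops"
  shows slice_ampliation: "slice h (blinfun_apply (ampliation t a) \<zeta>) = blinfun_apply a (slice h \<zeta>)"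
    and norm_ampliation_le: "norm (blinfun_apply (ampliation t a) \<zeta>) \<le> norm a * norm \<zeta>"
proof -
  obtain A where A: "\<And>h \<zeta>. slice h (A \<zeta>) = blinfun_apply a (slice h \<zeta>)"
    "\<And>\<zeta>. norm (A \<zeta>) \<le> norm a * norm \<zeta>"
    using ampliation_exists[OF a] by metis
  have lin: "bounded_linear A"
    by (rule bounded_linear_intro[where K = "norm a"])
      (auto intro!: eq_if_slice_eq simp: A slice_add scaleR_scaleC slice_scaleC blinfun.add_right
        bops_D[OF a] mult.commute[of "norm _" "norm a"])
  have "ampliation t a = Blinfun A"
    unfolding ampliation_def
  proof (rule the_equality)
    show "Blinfun A \<in> bops \<and> (\<forall>x h. blinfun_apply (Blinfun A) (t x h) = t (blinfun_apply a x) h)"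
      unfolding bops_def bounded_linear_Blinfun_apply[OF lin] mem_Collect_eq
      by (intro conjI allI eq_if_slice_eq) (simp_all add: A slice_scaleC slice_t bops_D[OF a])
    fix B
    assume B: "B \<in> bops \<and> (\<forall>x h. blinfun_apply B (t x h) = t (blinfun_apply a x) h)"
    have "blinfun_apply B \<zeta> = A \<zeta>" if "\<zeta> \<in> cspan (range (\<lambda>(x, h). t x h))" for \<zeta>
      using that
    proof (induction rule: cvec.span_induct_alt)
      case (step c b \<eta>)
      then obtain x h where b: "b = t x h"
        by auto
      have "A (c *\<^sub>C b + \<eta>) = c *\<^sub>C t (blinfun_apply a x) h + A \<eta>"
        unfolding b
        by (rule eq_if_slice_eq)
          (simp add: A slice_add slice_scaleC slice_t blinfun.add_right bops_D[OF a])
      then show ?case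
        using B step by (simp add: blinfun.add_right bops_D b)
    qed (simp add: linear_simps(3)[OF lin])
    then have "cspan (range (\<lambda>(x, h). t x h)) \<subseteq> {\<zeta>. blinfun_apply B \<zeta> = A \<zeta>}"
      by auto
    moreover have "closed {\<zeta>. blinfun_apply B \<zeta> = A \<zeta>}"
      by (intro closed_Collect_eq linear_continuous_on lin blinfun.bounded_linear_right)
    ultimately have "\<zeta> \<in> {\<zeta>. blinfun_apply B \<zeta> = A \<zeta>}" for \<zeta>
      using closure_minimal t_dense by blast
    then show "B = Blinfun A"
      by (intro blinfun_eqI) (simp add: bounded_linear_Blinfun_apply[OF lin])
  qed
  then show "slice h (blinfun_apply (ampliation t a) \<zeta>) = blinfun_apply a (slice h \<zeta>)"
    "norm (blinfun_apply (ampliation t a) \<zeta>) \<le> norm a * norm \<zeta>"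
    by (simp_all add: bounded_linear_Blinfun_apply[OF lin] A)
qed

abbreviation act :: "('l \<Rightarrow>\<^sub>L 'l) \<Rightarrow> 't \<Rightarrow> 't" where
  "act \<equiv> hilbert_tensor_action t"

lemma slice_act: "a \<in> bops \<Longrightarrow> slice h (act a \<zeta>) = blinfun_apply a (slice h \<zeta>)"
  and norm_act_le: "a \<in> bops \<Longrightarrow> norm (act a \<zeta>) \<le> norm a * norm \<zeta>"
  by (simp_all add: hilbert_tensor_action_def slice_ampliation norm_ampliation_le)

lemma act_t: "a \<in> bops \<Longrightarrow> act a (t x h) = t (blinfun_apply a x) h"
  by (rule eq_if_slice_eq) (simp add: slice_act slice_t bops_D)

lemma act_add: "a \<in> bops \<Longrightarrow> act a (\<zeta> + \<eta>) = act a \<zeta> + act a \<eta>"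
  by (rule eq_if_slice_eq) (simp add: slice_act slice_add blinfun.add_right)

lemma act_scaleC: "a \<in> bops \<Longrightarrow> act a (c *\<^sub>C \<zeta>) = c *\<^sub>C act a \<zeta>"
  by (rule eq_if_slice_eq) (simp add: slice_act slice_scaleC bops_D)

text \<open>An operator on the first leg commutes with the truncation, which touches only the
  second.\<close>

lemma act_trunc_space:
  assumes "a \<in> bops" "\<zeta> \<in> trunc_space S"
  shows "act a \<zeta> \<in> trunc_space S"
proof -
  have "slice g (trunc S (act a \<zeta>)) = slice g (act a (trunc S \<zeta>))" for g
    using assms(1) by (simp add: slice_trunc slice_act blinfun.sum_right bops_D)
  then have "trunc S (act a \<zeta>) = act a (trunc S \<zeta>)"
    by (rule eq_if_slice_eq)
  then show ?thesis
    using assms(2) by (simp add: trunc_space_def)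
qed

lemma act_alg:
  assumes "a \<in> bops" "\<zeta> \<in> alg_hilbert_tensor t"
  shows "act a \<zeta> \<in> alg_hilbert_tensor t"
proof -
  obtain S where "\<zeta> \<in> trunc_space S"
    using finite_alg_in_trunc_space[of "{\<zeta>}"] assms(2) by auto
  then show ?thesis
    using act_trunc_space[OF assms(1)] trunc_space_subset_alg by blast
qed

text \<open>Each module law becomes the corresponding law for operators once slices are taken. An
  arbitrary invariant \<open>X\<close> covers the algebraic and the completed tensor product
  together.\<close>

lemma contractive_left_module_act:
  assumes "csubspace X" "\<And>a \<zeta>. a \<in> bops \<Longrightarrow> \<zeta> \<in> X \<Longrightarrow> act a \<zeta> \<in> X"
  shows "contractive_left_module X act"
  unfolding contractive_left_module_def
  by (intro conjI ballI allI)
    (auto simp: assms act_add act_scaleC norm_act_le bops_add bops_scaleC bops_compose slice_act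
      slice_add slice_scaleC blinfun.add_left blinfun_apply_scaleC intro!: eq_if_slice_eq)

text \<open>The slice along any \<open>g\<close> is a combination of the slices along
  \<open>S\<close>, so finitely many slices bound the whole first leg.\<close>

lemma slices_in_span:
  assumes "\<zeta> \<in> trunc_space S" "(\<lambda>h. slice h \<zeta>) ` S \<subseteq> cspan A"
  shows "slice g \<zeta> \<in> cspan A"
proof -
  have "slice g (trunc S \<zeta>) \<in> cspan A"
    using assms(2) unfolding slice_trunc by (intro cvec.span_sum cvec.span_scale) auto
  then show ?thesis
    using assms(1) by (simp add: trunc_space_def)
qed

end


section \<open>Formal linear combinations\<close>

text \<open>The linear extension of \<open>\<beta>\<close> to formal sums; \<open>\<beta>\<close>
  need not be bilinear. Both \<open>push\<close> and the later \<open>coord\<close> are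
  instances.\<close>

definition ext :: "('y \<Rightarrow> 'x \<Rightarrow> 'w::complex_vector) \<Rightarrow> ('y, 'x) formal \<Rightarrow> 'w" where
  "ext \<beta> f = (\<Sum>(y, x)\<in>Poly_Mapping.keys f. Poly_Mapping.lookup f (y, x) *\<^sub>C \<beta> y x)"

lemma ext_superset:
  assumes "finite S" "Poly_Mapping.keys f \<subseteq> S"
  shows "ext \<beta> f = (\<Sum>(y, x)\<in>S. Poly_Mapping.lookup f (y, x) *\<^sub>C \<beta> y x)"
  unfolding ext_def using assms by (intro sum.mono_neutral_left) (auto simp: in_keys_iff)

lemma ext_add: "ext \<beta> (f + g) = ext \<beta> f + ext \<beta> g"
proof -
  let ?S = "Poly_Mapping.keys f \<union> Poly_Mapping.keys g"
  have "ext \<beta> (f + g) = (\<Sum>(y, x)\<in>?S. Poly_Mapping.lookup (f + g) (y, x) *\<^sub>C \<beta> y x)"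
    by (intro ext_superset) (auto simp: Poly_Mapping.keys_add)
  also have "\<dots> = (\<Sum>(y, x)\<in>?S. Poly_Mapping.lookup f (y, x) *\<^sub>C \<beta> y x) +
      (\<Sum>(y, x)\<in>?S. Poly_Mapping.lookup g (y, x) *\<^sub>C \<beta> y x)"
    by (simp add: lookup_add scaleC_add_left sum.distrib split_def)
  also have "\<dots> = ext \<beta> f + ext \<beta> g"
    by (intro arg_cong2[where f = plus] ext_superset[symmetric]) auto
  finally show ?thesis .
qed

lemma ext_scaleC: "ext \<beta> (c *\<^sub>C f) = c *\<^sub>C ext \<beta> f"
proof -
  have "ext \<beta> (c *\<^sub>C f) = (\<Sum>(y, x)\<in>Poly_Mapping.keys f. Poly_Mapping.lookup (c *\<^sub>C f) (y, x) *\<^sub>C \<beta> y x)"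
    by (intro ext_superset) (auto simp: in_keys_iff scaleC_poly_mapping.rep_eq scaleC_complex_def)
  then show ?thesis
    by (simp add: ext_def scaleC_poly_mapping.rep_eq scaleC_complex_def cvec.scale_sum_right
        split_def scaleC_scaleC)
qed

lemma ext_pair: "ext \<beta> (pair y x) = \<beta> y x"
  by (simp add: ext_def pair_def scaleC_one)

lemma ext_zero: "ext \<beta> 0 = 0"
  by (simp add: ext_def)

lemma ext_diff: "ext \<beta> (f - g) = ext \<beta> f - ext \<beta> g"
  using ext_add[of \<beta> "f - g" g] by (simp add: eq_diff_eq)

lemma push_eq_ext: "push \<alpha> = ext (\<lambda>y x. pair (\<alpha> y) x)"
  by (simp add: push_def ext_def fun_eq_iff)

lemma ext_in_subspace:
  assumes "f \<in> cspan A" "csubspace W" "\<And>g. g \<in> A \<Longrightarrow> ext \<beta> g \<in> W"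
  shows "ext \<beta> f \<in> W"
  using assms(1)
  by (induction rule: cvec.span_induct_alt)
    (auto simp: ext_zero ext_add ext_scaleC intro: cvec.subspace_0[OF assms(2)]
      cvec.subspace_add[OF assms(2)] cvec.subspace_scale[OF assms(2)] assms(3))

lemma formals_subspace: "csubspace (formals Y X)"
proof (intro cvec.subspaceI)
  show "c *\<^sub>C f \<in> formals Y X" if "f \<in> formals Y X" for c f
    using that
    by (auto simp: formals_def in_keys_iff scaleC_poly_mapping.rep_eq scaleC_complex_def subset_iff)
qed (use Poly_Mapping.keys_add in \<open>fastforce simp: formals_def\<close>)+

lemma pair_in_formals: "y \<in> Y \<Longrightarrow> x \<in> X \<Longrightarrow> pair y x \<in> formals Y X"
  by (auto simp: pair_def formals_def)

lemma eq_ext_pair: "f = ext pair f"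
proof (rule poly_mapping_eqI)
  fix p
  have "Poly_Mapping.lookup (ext pair f) p =
    (\<Sum>q\<in>Poly_Mapping.keys f. if q = p then Poly_Mapping.lookup f p else 0)"
    unfolding ext_def lookup_sum
    by (intro sum.cong) (auto simp: pair_def lookup_single scaleC_poly_mapping.rep_eq scaleC_complex_def when_def)
  then show "Poly_Mapping.lookup f p = Poly_Mapping.lookup (ext pair f) p"
    by (simp add: in_keys_iff)
qed

lemma formals_eq_cspan: "formals Y X = cspan {pair y x | y x. y \<in> Y \<and> x \<in> X}"
proof
  show "formals Y X \<subseteq> cspan {pair y x | y x. y \<in> Y \<and> x \<in> X}"
  proof
    fix f
    assume "f \<in> formals Y X"
    then have "ext pair f \<in> cspan {pair y x | y x. y \<in> Y \<and> x \<in> X}"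
      unfolding ext_def formals_def split_def
      by (intro cvec.span_sum cvec.span_scale cvec.span_base) fastforce
    then show "f \<in> cspan {pair y x | y x. y \<in> Y \<and> x \<in> X}"
      using eq_ext_pair[of f] by simp
  qed
  show "cspan {pair y x | y x. y \<in> Y \<and> x \<in> X} \<subseteq> formals Y X"
    by (intro cvec.span_minimal formals_subspace) (auto intro: pair_in_formals)
qed

lemma formals_induct [consumes 1, case_names zero step]:
  assumes "f \<in> formals Y X" "P 0"
    and "\<And>c y x g. y \<in> Y \<Longrightarrow> x \<in> X \<Longrightarrow> g \<in> formals Y X \<Longrightarrow> P g \<Longrightarrow> P (c *\<^sub>C pair y x + g)"
  shows "P f"
proof -
  have "f \<in> formals Y X \<and> P f"
    using assms(1) unfolding formals_eq_cspan
  proof (induction rule: cvec.span_induct_alt)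
    case (step c b g)
    then have "c *\<^sub>C b + g \<in> cspan {pair y x | y x. y \<in> Y \<and> x \<in> X}"
      by (intro cvec.span_add cvec.span_scale) (auto intro: cvec.span_base)
    then show ?case
      using step assms(3) unfolding formals_eq_cspan by auto
  qed (simp add: assms(2) cvec.span_zero)
  then show ?thesis ..
qed

lemma formals_mono: "X \<subseteq> X' \<Longrightarrow> formals Y X \<subseteq> formals Y X'"
  by (auto simp: formals_def)

lemma ext_in: "f \<in> formals Y X \<Longrightarrow> csubspace W \<Longrightarrow> (\<And>y x. y \<in> Y \<Longrightarrow> x \<in> X \<Longrightarrow> \<beta> y x \<in> W) \<Longrightarrow> ext \<beta> f \<in> W"
  unfolding formals_eq_cspan by (erule ext_in_subspace) (auto simp: ext_pair)


section \<open>Quotient seminorms\<close>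

definition cost :: "('y::real_normed_vector \<times> 'x::real_normed_vector) list \<Rightarrow> real" where
  "cost ps = (\<Sum>(y, x)\<leftarrow>ps. norm y * norm x)"

definition formal :: "('y \<times> 'x) list \<Rightarrow> ('y, 'x) formal" where
  "formal ps = (\<Sum>(y, x)\<leftarrow>ps. pair y x)"

text \<open>The subspace \<open>V\<close> of relations is a parameter: \<open>bilin_rel Y X\<close>
  yields the projective norm, and adding the balancing relations yields the seminorm of the tensor
  product over the operators.\<close>

definition rep_norm ::
  "'y::complex_normed_vector set \<Rightarrow> 'x::complex_normed_vector set \<Rightarrow> ('y, 'x) formal set \<Rightarrow>
   ('y, 'x) formal \<Rightarrow> real" where
  "rep_norm Y X V f = Inf {cost ps | ps. set ps \<subseteq> Y \<times> X \<and> formal ps - f \<in> V}"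

lemma cost_simps [simp]:
  "cost [] = 0" "cost ((y, x) # ps) = norm y * norm x + cost ps" "cost (ps @ qs) = cost ps + cost qs"
  by (simp_all add: cost_def)

lemma formal_simps [simp]:
  "formal [] = 0" "formal ((y, x) # ps) = pair y x + formal ps" "formal (ps @ qs) = formal ps + formal qs"
  by (simp_all add: formal_def)

lemma cost_nonneg: "0 \<le> cost ps"
  by (auto simp: cost_def intro!: sum_list_nonneg)

lemma bilin_rel_gens:
  "y \<in> Y \<Longrightarrow> y' \<in> Y \<Longrightarrow> x \<in> X \<Longrightarrow> pair (y + y') x - pair y x - pair y' x \<in> bilin_rel Y X"
  "y \<in> Y \<Longrightarrow> x \<in> X \<Longrightarrow> x' \<in> X \<Longrightarrow> pair y (x + x') - pair y x - pair y x' \<in> bilin_rel Y X"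
  "y \<in> Y \<Longrightarrow> x \<in> X \<Longrightarrow> pair (c *\<^sub>C y) x - c *\<^sub>C pair y x \<in> bilin_rel Y X"
  "y \<in> Y \<Longrightarrow> x \<in> X \<Longrightarrow> pair y (c *\<^sub>C x) - c *\<^sub>C pair y x \<in> bilin_rel Y X"
  unfolding bilin_rel_def by (rule cvec.span_base; blast)+

lemma bilin_rel_subspace: "csubspace (bilin_rel Y X)"
  by (simp add: bilin_rel_def cvec.subspace_span)

locale relations =
  fixes Y :: "'y::complex_normed_vector set" and X :: "'x::complex_normed_vector set"
    and V :: "('y, 'x) formal set"
  assumes Y: "csubspace Y" and X: "csubspace X" and V: "csubspace V" and bilin_V: "bilin_rel Y X \<subseteq> V"
begin

definition cong :: "('y, 'x) formal \<Rightarrow> ('y, 'x) formal \<Rightarrow> bool"  (infix \<open>\<doteq>\<close> 50) where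
  "f \<doteq> g \<longleftrightarrow> f - g \<in> V"

lemma cong_refl [simp]: "f \<doteq> f"
  using cvec.subspace_0[OF V] by (simp add: cong_def)

lemma cong_sym: "f \<doteq> g \<Longrightarrow> g \<doteq> f"
  using cvec.subspace_neg[OF V, of "f - g"] by (simp add: cong_def)

lemma cong_trans [trans]: "f \<doteq> g \<Longrightarrow> g \<doteq> h \<Longrightarrow> f \<doteq> h"
  using cvec.subspace_add[OF V, of "f - g" "g - h"] by (simp add: cong_def)

lemma cong_add: "f \<doteq> g \<Longrightarrow> f' \<doteq> g' \<Longrightarrow> f + f' \<doteq> g + g'"
  using cvec.subspace_add[OF V, of "f - g" "f' - g'"] by (simp add: cong_def algebra_simps)

lemma cong_scaleC: "f \<doteq> g \<Longrightarrow> c *\<^sub>C f \<doteq> c *\<^sub>C g"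
  using cvec.subspace_scale[OF V, of "f - g" c] by (simp add: cong_def cvec.scale_right_diff_distrib)

lemma cong_sum: "(\<And>i. i \<in> S \<Longrightarrow> f i \<doteq> g i) \<Longrightarrow> (\<Sum>i\<in>S. f i) \<doteq> (\<Sum>i\<in>S. g i)"
  by (induction S rule: infinite_finite_induct) (auto intro: cong_add)

lemma cong_add_left: "y \<in> Y \<Longrightarrow> y' \<in> Y \<Longrightarrow> x \<in> X \<Longrightarrow> pair (y + y') x \<doteq> pair y x + pair y' x"
  and cong_add_right: "y \<in> Y \<Longrightarrow> x \<in> X \<Longrightarrow> x' \<in> X \<Longrightarrow> pair y (x + x') \<doteq> pair y x + pair y x'"
  and cong_scaleC_left: "y \<in> Y \<Longrightarrow> x \<in> X \<Longrightarrow> pair (c *\<^sub>C y) x \<doteq> c *\<^sub>C pair y x"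
  and cong_scaleC_right: "y \<in> Y \<Longrightarrow> x \<in> X \<Longrightarrow> pair y (c *\<^sub>C x) \<doteq> c *\<^sub>C pair y x"
  using bilin_rel_gens[THEN subsetD[OF bilin_V]] by (simp_all add: cong_def diff_diff_eq)

lemma cong_zero_left: "x \<in> X \<Longrightarrow> pair 0 x \<doteq> 0"
  using cong_scaleC_left[of 0 x 0] cvec.subspace_0[OF Y] by simp

lemma cong_zero_right: "y \<in> Y \<Longrightarrow> pair y 0 \<doteq> 0"
  using cong_scaleC_right[of y 0 0] cvec.subspace_0[OF X] by simp

lemma cong_sum_right: "y \<in> Y \<Longrightarrow> (\<And>i. i \<in> S \<Longrightarrow> x i \<in> X) \<Longrightarrow> pair y (\<Sum>i\<in>S. x i) \<doteq> (\<Sum>i\<in>S. pair y (x i))"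
proof (induction S rule: infinite_finite_induct)
  case (insert i S)
  have "pair y (\<Sum>i\<in>insert i S. x i) \<doteq> pair y (x i) + pair y (\<Sum>i\<in>S. x i)"
    using insert by (simp add: cong_add_right cvec.subspace_sum[OF X])
  also have "\<dots> \<doteq> pair y (x i) + (\<Sum>i\<in>S. pair y (x i))"
    using insert by (intro cong_add) auto
  finally show ?case
    using insert by simp
qed (auto intro: cong_zero_right)

abbreviation seminorm :: "('y, 'x) formal \<Rightarrow> real" where
  "seminorm \<equiv> rep_norm Y X V"

lemma seminorm_le: "set ps \<subseteq> Y \<times> X \<Longrightarrow> formal ps \<doteq> f \<Longrightarrow> seminorm f \<le> cost ps"
  unfolding rep_norm_def cong_def using cost_nonneg by (intro cInf_lower bdd_belowI[of _ 0]) auto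

text \<open>Ensures that the infimum in \<open>rep_norm\<close> is over a nonempty set; a
  coefficient is absorbed into the left factor.\<close>

lemma rep_exists: "f \<in> formals Y X \<Longrightarrow> \<exists>ps. set ps \<subseteq> Y \<times> X \<and> formal ps \<doteq> f"
proof (induction rule: formals_induct)
  case zero
  show ?case
    by (intro exI[of _ "[]"]) simp
next
  case (step c y x g)
  then obtain ps where "set ps \<subseteq> Y \<times> X" "formal ps \<doteq> g"
    by blast
  then show ?case
    using step by (intro exI[of _ "(c *\<^sub>C y, x) # ps"])
      (auto intro!: cvec.subspace_scale[OF Y] cong_add cong_scaleC_left)
qed

lemma seminorm_less:
  assumes "f \<in> formals Y X" "seminorm f < r"
  obtains ps where "set ps \<subseteq> Y \<times> X" "formal ps \<doteq> f" "cost ps < r"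
  using cInf_lessD[OF _ assms(2)[unfolded rep_norm_def]] rep_exists[OF assms(1)]
  unfolding cong_def by blast

lemma seminorm_nonneg: "f \<in> formals Y X \<Longrightarrow> 0 \<le> seminorm f"
  unfolding rep_norm_def using rep_exists[of f, unfolded cong_def] cost_nonneg
  by (intro cInf_greatest) auto

lemma seminorm_cong: "f \<doteq> g \<Longrightarrow> seminorm f = seminorm g"
proof -
  assume "f \<doteq> g"
  then have "formal ps - f \<in> V \<longleftrightarrow> formal ps - g \<in> V" for ps
    using cong_trans cong_sym unfolding cong_def[symmetric] by blast
  then show ?thesis
    by (simp add: rep_norm_def)
qed

lemma seminorm_zero: "seminorm 0 = 0"
  using seminorm_le[of "[]" 0] seminorm_nonneg[OF cvec.subspace_0[OF formals_subspace]]
  by simp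

lemma seminorm_pair_le: "y \<in> Y \<Longrightarrow> x \<in> X \<Longrightarrow> seminorm (pair y x) \<le> norm y * norm x"
  using seminorm_le[of "[(y, x)]" "pair y x"] by simp

lemma seminorm_add_le:
  assumes "f \<in> formals Y X" "g \<in> formals Y X"
  shows "seminorm (f + g) \<le> seminorm f + seminorm g"
proof (rule field_le_epsilon)
  fix e :: real
  assume "0 < e"
  obtain ps where ps: "set ps \<subseteq> Y \<times> X" "formal ps \<doteq> f" "cost ps < seminorm f + e / 2"
    using seminorm_less[OF assms(1), of "seminorm f + e / 2"] \<open>0 < e\<close> by auto
  obtain qs where qs: "set qs \<subseteq> Y \<times> X" "formal qs \<doteq> g" "cost qs < seminorm g + e / 2"
    using seminorm_less[OF assms(2), of "seminorm g + e / 2"] \<open>0 < e\<close> by auto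
  have "seminorm (f + g) \<le> cost (ps @ qs)"
    using ps qs by (intro seminorm_le) (auto intro: cong_add)
  then show "seminorm (f + g) \<le> seminorm f + seminorm g + e"
    using ps qs by simp
qed

lemma seminorm_scaleC_le:
  assumes "f \<in> formals Y X"
  shows "seminorm (c *\<^sub>C f) \<le> cmod c * seminorm f"
proof (rule field_le_epsilon)
  fix e :: real
  assume "0 < e"
  \<comment> \<open>The summand 1 in the denominator covers the case \<open>c = 0\<close>.\<close>
  then have "seminorm f < seminorm f + e / (cmod c + 1)"
    by (simp add: add_nonneg_pos)
  then obtain ps where ps: "set ps \<subseteq> Y \<times> X" "formal ps \<doteq> f" "cost ps < seminorm f + e / (cmod c + 1)"
    using seminorm_less[OF assms] by metis
  define qs where "qs = map (\<lambda>(y, x). (c *\<^sub>C y, x)) ps"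
  have "set qs \<subseteq> Y \<times> X \<and> formal qs \<doteq> c *\<^sub>C formal ps \<and> cost qs = cmod c * cost ps"
    using ps(1) unfolding qs_def
    by (induction ps) (auto simp: norm_scaleC distrib_left scaleC_add_right
        intro!: cvec.subspace_scale[OF Y] cong_add[of "pair _ _" _ "formal _"] cong_scaleC_left)
  then have "seminorm (c *\<^sub>C f) \<le> cmod c * cost ps"
    using ps(2) seminorm_le cong_trans cong_scaleC by metis
  also have "\<dots> \<le> cmod c * (seminorm f + e / (cmod c + 1))"
    using ps(3) by (intro mult_left_mono) auto
  also have "\<dots> \<le> cmod c * seminorm f + e"
    using \<open>0 < e\<close> by (simp add: field_simps add_pos_nonneg)
  finally show "seminorm (c *\<^sub>C f) \<le> cmod c * seminorm f + e" .
qed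

lemma seminorm_uminus_le: "f \<in> formals Y X \<Longrightarrow> seminorm (- f) \<le> seminorm f"
  using seminorm_scaleC_le[of f "-1"] by (simp add: scaleC_minus_one)

lemma seminorm_diff_le:
  "f \<in> formals Y X \<Longrightarrow> g \<in> formals Y X \<Longrightarrow> seminorm (f - g) \<le> seminorm f + seminorm g"
  using seminorm_add_le[of f "- g"] seminorm_uminus_le[of g] cvec.subspace_neg[OF formals_subspace, of g]
  by simp

end


section \<open>Balanced tensor products\<close>

locale right_module =
  fixes Y :: "'y::complex_normed_vector set" and m :: "'y \<Rightarrow> ('l::complex_normed_vector \<Rightarrow>\<^sub>L 'l) \<Rightarrow> 'y"
  assumes right_module: "contractive_right_module Y m"
begin

lemma right_subspace: "csubspace Y"
  and m_closed: "a \<in> bops \<Longrightarrow> y \<in> Y \<Longrightarrow> m y a \<in> Y"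
  and m_add: "a \<in> bops \<Longrightarrow> y \<in> Y \<Longrightarrow> y' \<in> Y \<Longrightarrow> m (y + y') a = m y a + m y' a"
  and m_scaleC: "a \<in> bops \<Longrightarrow> y \<in> Y \<Longrightarrow> m (c *\<^sub>C y) a = c *\<^sub>C m y a"
  and m_add_op: "a \<in> bops \<Longrightarrow> b \<in> bops \<Longrightarrow> y \<in> Y \<Longrightarrow> m y (a + b) = m y a + m y b"
  and m_scaleC_op: "a \<in> bops \<Longrightarrow> y \<in> Y \<Longrightarrow> m y (c *\<^sub>C a) = c *\<^sub>C m y a"
  and m_compose: "a \<in> bops \<Longrightarrow> b \<in> bops \<Longrightarrow> y \<in> Y \<Longrightarrow> m y (a o\<^sub>L b) = m (m y a) b"
  and norm_m_le: "a \<in> bops \<Longrightarrow> y \<in> Y \<Longrightarrow> norm (m y a) \<le> norm a * norm y"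
  using right_module unfolding contractive_right_module_def by blast+

lemma norm_m_le_contraction: "a \<in> bops \<Longrightarrow> y \<in> Y \<Longrightarrow> norm a \<le> 1 \<Longrightarrow> norm (m y a) \<le> norm y"
  using norm_m_le mult_right_mono[of "norm a" 1 "norm y"] by fastforce

lemma m_zero_op: "y \<in> Y \<Longrightarrow> m y 0 = 0"
  using m_scaleC_op[of 0 y 0] by simp

end

locale balanced = right_module Y m
  for Y :: "'y::complex_normed_vector set" and m :: "'y \<Rightarrow> ('l::complex_normed_vector \<Rightarrow>\<^sub>L 'l) \<Rightarrow> 'y" +
  fixes X :: "'x::complex_normed_vector set" and k :: "('l \<Rightarrow>\<^sub>L 'l) \<Rightarrow> 'x \<Rightarrow> 'x"
  assumes left_module: "contractive_left_module X k"
begin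

lemma left_subspace: "csubspace X"
  and k_closed: "a \<in> bops \<Longrightarrow> x \<in> X \<Longrightarrow> k a x \<in> X"
  using left_module unfolding contractive_left_module_def by blast+

definition balanced_gens :: "('y, 'x) formal set" where
  "balanced_gens = {pair (m y a) x - pair y (k a x) | y a x. y \<in> Y \<and> a \<in> bops \<and> x \<in> X}"

text \<open>The algebraic relations alone, without closure. Only a seminorm results, but formal sums
  modulo \<open>R\<close> can be manipulated by finite computations.\<close>

definition R :: "('y, 'x) formal set" where
  "R = cspan (bilin_rel Y X \<union> balanced_gens)"

sublocale bilin: relations Y X "bilin_rel Y X"
  by unfold_locales (auto simp: right_subspace left_subspace bilin_rel_subspace)

sublocale relations Y X R
  by unfold_locales
    (auto simp: right_subspace left_subspace R_def cvec.subspace_span intro: cvec.span_base)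

notation cong  (infix \<open>\<doteq>\<close> 50)

lemma cong_balanced: "y \<in> Y \<Longrightarrow> a \<in> bops \<Longrightarrow> x \<in> X \<Longrightarrow> pair (m y a) x \<doteq> pair y (k a x)"
  unfolding cong_def unfolding R_def balanced_gens_def by (rule cvec.span_base) blast

lemma R_split: "f \<in> R \<longleftrightarrow> (\<exists>r b. f = r + b \<and> r \<in> bilin_rel Y X \<and> b \<in> cspan balanced_gens)"
proof -
  have "cspan (bilin_rel Y X) = bilin_rel Y X"
    using bilin_rel_subspace by (rule cvec.span_eq_iff[THEN iffD2])
  then have "R = {r + b | r b. r \<in> bilin_rel Y X \<and> b \<in> cspan balanced_gens}"
    unfolding R_def cvec.span_Un by (simp only:)
  then show ?thesis
    by auto
qed

lemma bilin_cong: "bilin.cong f g \<Longrightarrow> f \<doteq> g"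
  using bilin_V by (auto simp: cong_def bilin.cong_def)

lemma balanced_gens_formals: "cspan balanced_gens \<subseteq> formals Y X"
  by (rule cvec.span_minimal[OF _ formals_subspace])
    (auto simp: balanced_gens_def m_closed k_closed
      intro!: cvec.subspace_diff[OF formals_subspace] pair_in_formals)

lemma bilin_rel_formals: "bilin_rel Y X \<subseteq> formals Y X"
  unfolding bilin_rel_def
  by (rule cvec.span_minimal[OF _ formals_subspace])
    (auto intro!: cvec.subspace_diff[OF formals_subspace] pair_in_formals
      cvec.subspace_scale[OF formals_subspace] cvec.subspace_add[OF right_subspace]
      cvec.subspace_scale[OF right_subspace] cvec.subspace_add[OF left_subspace]
      cvec.subspace_scale[OF left_subspace])

section \<open>From cosets to the seminorm on formal sums\<close>

lemma mem_tensor_class: "f \<in> tensor_class Y X g \<longleftrightarrow> bilin.cong f g"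
  unfolding tensor_class_def elt_set_plus_def bilin.cong_def
  by (auto simp: algebra_simps intro!: bexI[of _ "f - g"])

lemma tensor_class_add: "tensor_class Y X f + tensor_class Y X g = tensor_class Y X (f + g)"
proof (intro set_eqI iffI)
  fix h
  assume "h \<in> tensor_class Y X (f + g)"
  then have "bilin.cong (h - g) f"
    by (simp add: mem_tensor_class bilin.cong_def algebra_simps)
  then have "h - g \<in> tensor_class Y X f" "g \<in> tensor_class Y X g"
    by (simp_all add: mem_tensor_class)
  then show "h \<in> tensor_class Y X f + tensor_class Y X g"
    using set_plus_intro[of "h - g" _ g] by fastforce
qed (auto simp: set_plus_def mem_tensor_class intro: bilin.cong_add)

lemma tensor_class_diff:
  "{p - q | p q. p \<in> tensor_class Y X f \<and> q \<in> tensor_class Y X g} = tensor_class Y X (f - g)"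
proof (intro set_eqI iffI)
  fix h
  assume "h \<in> tensor_class Y X (f - g)"
  then have "bilin.cong (h + g) f"
    by (simp add: mem_tensor_class bilin.cong_def algebra_simps)
  then have "h + g \<in> tensor_class Y X f" "g \<in> tensor_class Y X g"
    by (simp_all add: mem_tensor_class)
  then show "h \<in> {p - q | p q. p \<in> tensor_class Y X f \<and> q \<in> tensor_class Y X g}"
    by force
next
  fix h
  assume "h \<in> {p - q | p q. p \<in> tensor_class Y X f \<and> q \<in> tensor_class Y X g}"
  then obtain p q where "h = p - q" "bilin.cong p f" "bilin.cong q g"
    by (auto simp: mem_tensor_class)
  then show "h \<in> tensor_class Y X (f - g)"
    using bilin.cong_add[OF _ bilin.cong_scaleC[of q g "-1"]]
    by (simp add: mem_tensor_class scaleC_minus_one)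
qed

lemma proj_norm_tensor_class: "proj_norm Y X (tensor_class Y X f) = bilin.seminorm f"
  unfolding proj_norm_def rep_norm_def mem_tensor_class bilin.cong_def cost_def formal_def ..

text \<open>Lying in the closure means having projective distance 0 from the balanced span, and this
  distance is the seminorm modulo \<open>R\<close>: a cheap representation modulo \<open>R\<close>
  is one modulo bilinearity after subtracting a balanced combination.\<close>

lemma mem_N1: "u \<in> N1 Y m X k \<longleftrightarrow> (\<exists>g\<in>formals Y X. u = tensor_class Y X g \<and> seminorm g = 0)"
proof
  assume "u \<in> N1 Y m X k"
  then obtain g where g: "g \<in> formals Y X" "u = tensor_class Y X g"
    and close: "\<forall>e>0. \<exists>v\<in>balanced_span Y m X k. proj_norm Y X {p - q | p q. p \<in> u \<and> q \<in> v} < e"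
    by (auto simp: N1_def alg_tensor_def)
  have "seminorm g \<le> 0"
  proof (rule field_le_epsilon)
    fix e :: real
    assume "0 < e"
    then obtain b where b: "b \<in> cspan balanced_gens" "bilin.seminorm (g - b) < e"
      using close unfolding balanced_span_def balanced_gens_def[symmetric] g(2)
      by (auto simp: tensor_class_diff proj_norm_tensor_class)
    have "g - b \<in> formals Y X"
      using g(1) b(1) balanced_gens_formals by (intro cvec.subspace_diff[OF formals_subspace]) auto
    then obtain ps where ps: "set ps \<subseteq> Y \<times> X" "bilin.cong (formal ps) (g - b)" "cost ps < e"
      using bilin.seminorm_less[OF _ b(2)] by metis
    have "b \<in> R"
      using b(1) cvec.subspace_0[OF bilin_rel_subspace] unfolding R_split by force
    then have "g - b \<doteq> g"
      using cvec.subspace_neg[OF V] by (simp add: cong_def)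
    then have "formal ps \<doteq> g"
      using bilin_cong[OF ps(2)] cong_trans by blast
    then show "seminorm g \<le> 0 + e"
      using seminorm_le[OF ps(1)] ps(3) by fastforce
  qed
  then show "\<exists>g\<in>formals Y X. u = tensor_class Y X g \<and> seminorm g = 0"
    using g seminorm_nonneg[OF g(1)] by (intro bexI[of _ g]) auto
next
  assume "\<exists>g\<in>formals Y X. u = tensor_class Y X g \<and> seminorm g = 0"
  then obtain g where g: "g \<in> formals Y X" "u = tensor_class Y X g" "seminorm g = 0"
    by blast
  have "\<exists>v\<in>balanced_span Y m X k. proj_norm Y X {p - q | p q. p \<in> u \<and> q \<in> v} < e" if "e > 0" for e
  proof -
    obtain ps where ps: "set ps \<subseteq> Y \<times> X" "formal ps \<doteq> g" "cost ps < e"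
      using seminorm_less[OF g(1), of e] g(3) \<open>e > 0\<close> by metis
    then obtain r b where rb: "formal ps - g = r + b" "r \<in> bilin_rel Y X" "b \<in> cspan balanced_gens"
      unfolding cong_def R_split by blast
    have "bilin.cong (formal ps) (g - (- b))"
      using rb(1,2) by (simp add: bilin.cong_def algebra_simps)
    then have "bilin.seminorm (g - (- b)) < e"
      using bilin.seminorm_le[OF ps(1)] ps(3) by fastforce
    moreover have "- b \<in> cspan balanced_gens"
      using rb(3) by (rule cvec.span_neg)
    ultimately show ?thesis
      unfolding balanced_span_def balanced_gens_def[symmetric] g(2)
      by (intro bexI[of _ "tensor_class Y X (- b)"])
        (auto simp: tensor_class_diff proj_norm_tensor_class)
  qed
  then show "u \<in> N1 Y m X k"
    using g by (auto simp: N1_def alg_tensor_def)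
qed

lemma mem_mod_tensor_class:
  "u \<in> mod_tensor_class Y m X k f \<longleftrightarrow>
    (\<exists>g\<in>formals Y X. u = tensor_class Y X (f + g) \<and> seminorm g = 0)"
  unfolding mod_tensor_class_def elt_set_plus_def by (force simp: mem_N1 tensor_class_add[symmetric])

lemma mod_tensor_eq: "mod_tensor Y m X k = mod_tensor_class Y m X k ` formals Y X"
  by (auto simp: mod_tensor_def mod_tensor_class_def alg_tensor_def)

text \<open>Elements of the coset differ from \<open>f\<close> by null elements, which leave the
  seminorm unchanged, and the seminorm is at most the projective norm. Conversely every
  representation of \<open>f\<close> modulo \<open>R\<close> is a representation, modulo
  bilinearity, of some member of the coset.\<close>

lemma mod_tensor_norm_class:
  assumes "f \<in> formals Y X"
  shows "mod_tensor_norm Y X (mod_tensor_class Y m X k f) = seminorm f"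
  unfolding mod_tensor_norm_def
proof (rule cInf_eq_non_empty)
  let ?U = "mod_tensor_class Y m X k f"
  have zero: "0 \<in> formals Y X"
    by (rule cvec.subspace_0[OF formals_subspace])
  then have "tensor_class Y X f \<in> ?U"
    unfolding mem_mod_tensor_class using seminorm_zero by force
  then show "proj_norm Y X ` ?U \<noteq> {}"
    by blast
  fix c
  assume "c \<in> proj_norm Y X ` ?U"
  then obtain g where g: "g \<in> formals Y X" "c = bilin.seminorm (f + g)" "seminorm g = 0"
    by (auto simp: mem_mod_tensor_class proj_norm_tensor_class)
  have fg: "f + g \<in> formals Y X"
    using assms g(1) by (rule cvec.subspace_add[OF formals_subspace])
  have "seminorm f \<le> seminorm (f + g)"
    using seminorm_diff_le[OF fg g(1)] g(3) by simp
  also have "\<dots> \<le> bilin.seminorm (f + g)"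
  proof (rule field_le_epsilon)
    fix e :: real
    assume "0 < e"
    then obtain ps where "set ps \<subseteq> Y \<times> X" "bilin.cong (formal ps) (f + g)" "cost ps < bilin.seminorm (f + g) + e"
      using bilin.seminorm_less[OF fg, of "bilin.seminorm (f + g) + e"] by auto
    then show "seminorm (f + g) \<le> bilin.seminorm (f + g) + e"
      using seminorm_le[of ps "f + g"] bilin_cong by fastforce
  qed
  finally show "seminorm f \<le> c"
    using g(2) by simp
next
  let ?U = "mod_tensor_class Y m X k f"
  fix l
  assume l: "\<And>c. c \<in> proj_norm Y X ` ?U \<Longrightarrow> l \<le> c"
  show "l \<le> seminorm f"
  proof (rule field_le_epsilon)
    fix e :: real
    assume "0 < e"
    then obtain ps where ps: "set ps \<subseteq> Y \<times> X" "formal ps \<doteq> f" "cost ps < seminorm f + e"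
      using seminorm_less[OF assms, of "seminorm f + e"] by auto
    then obtain r b where rb: "formal ps - f = r + b" "r \<in> bilin_rel Y X" "b \<in> cspan balanced_gens"
      unfolding cong_def R_split by blast
    have b: "b \<in> formals Y X"
      using rb(3) balanced_gens_formals by blast
    have "b \<in> R"
      using rb(3) cvec.subspace_0[OF bilin_rel_subspace] unfolding R_split by force
    then have "seminorm b = 0"
      using seminorm_cong[of b 0] seminorm_zero by (simp add: cong_def)
    \<comment> \<open>Adding the balanced part \<open>b\<close> stays in the coset and makes
      \<open>ps\<close> a representation modulo bilinearity alone.\<close>
    then have "tensor_class Y X (f + b) \<in> ?U"
      using b mem_mod_tensor_class by blast
    then have "l \<le> bilin.seminorm (f + b)"
      using l[OF imageI, of "tensor_class Y X (f + b)"] by (simp add: proj_norm_tensor_class)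
    also have "\<dots> \<le> cost ps"
      using rb(1,2) by (intro bilin.seminorm_le ps(1)) (simp add: bilin.cong_def algebra_simps)
    finally show "l \<le> seminorm f + e"
      using ps(3) by simp
  qed
qed

lemma mod_tensor_class_eqI:
  assumes "f - g \<in> formals Y X" "seminorm (f - g) = 0"
  shows "mod_tensor_class Y m X k f = mod_tensor_class Y m X k g"
proof -
  have "mod_tensor_class Y m X k f \<subseteq> mod_tensor_class Y m X k g"
    if "f - g \<in> formals Y X" "seminorm (f - g) = 0" for f g
  proof
    fix u
    assume "u \<in> mod_tensor_class Y m X k f"
    then obtain h where h: "h \<in> formals Y X" "u = tensor_class Y X (f + h)" "seminorm h = 0"
      by (auto simp: mem_mod_tensor_class)
    have sum: "f - g + h \<in> formals Y X"
      using that(1) h(1) by (rule cvec.subspace_add[OF formals_subspace])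
    then have "seminorm (f - g + h) = 0"
      using seminorm_add_le[OF that(1) h(1)] seminorm_nonneg[OF sum] that(2) h(3) by simp
    then show "u \<in> mod_tensor_class Y m X k g"
      using sum h(2) unfolding mem_mod_tensor_class by (intro bexI[of _ "f - g + h"]) simp_all
  qed
  moreover have "g - f \<in> formals Y X"
    using cvec.subspace_neg[OF formals_subspace assms(1)] by simp
  moreover have "seminorm (g - f) = 0"
    using seminorm_uminus_le[OF assms(1)] seminorm_nonneg[OF \<open>g - f \<in> formals Y X\<close>] assms(2) by simp
  ultimately show ?thesis
    using assms by blast
qed

lemma Union_mod_tensor_class:
  assumes "f \<in> formals Y X" "g \<in> \<Union> (mod_tensor_class Y m X k f)"
  shows "g - f \<in> formals Y X" "seminorm (g - f) = 0"
proof -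
  obtain h where h: "h \<in> formals Y X" "bilin.cong g (f + h)" "seminorm h = 0"
    using assms(2) by (auto simp: mem_mod_tensor_class mem_tensor_class)
  have "bilin.cong (g - f) h"
    using h(2) by (simp add: bilin.cong_def diff_diff_eq)
  then have "g - f - h \<in> formals Y X"
    using bilin_rel_formals by (auto simp: bilin.cong_def)
  then show "g - f \<in> formals Y X"
    using cvec.subspace_add[OF formals_subspace _ h(1)] by fastforce
  show "seminorm (g - f) = 0"
    using seminorm_cong[OF bilin_cong[OF \<open>bilin.cong (g - f) h\<close>]] h(3) by simp
qed

text \<open>The universal property, with the identities required only modulo a subspace
  \<open>W\<close> of the target. \<open>push\<close> uses the relations of the other tensor product
  as \<open>W\<close>, the coordinates use \<open>{0}\<close>.\<close>

lemma ext_cong: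
  assumes W: "csubspace W"
    and "\<And>y y' x. y \<in> Y \<Longrightarrow> y' \<in> Y \<Longrightarrow> x \<in> X \<Longrightarrow> \<beta> (y + y') x - \<beta> y x - \<beta> y' x \<in> W"
    and "\<And>y x x'. y \<in> Y \<Longrightarrow> x \<in> X \<Longrightarrow> x' \<in> X \<Longrightarrow> \<beta> y (x + x') - \<beta> y x - \<beta> y x' \<in> W"
    and "\<And>c y x. y \<in> Y \<Longrightarrow> x \<in> X \<Longrightarrow> \<beta> (c *\<^sub>C y) x - c *\<^sub>C \<beta> y x \<in> W"
    and "\<And>c y x. y \<in> Y \<Longrightarrow> x \<in> X \<Longrightarrow> \<beta> y (c *\<^sub>C x) - c *\<^sub>C \<beta> y x \<in> W"
    and "\<And>y a x. y \<in> Y \<Longrightarrow> a \<in> bops \<Longrightarrow> x \<in> X \<Longrightarrow> \<beta> (m y a) x - \<beta> y (k a x) \<in> W"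
    and "f \<doteq> g"
  shows "ext \<beta> f - ext \<beta> g \<in> W"
proof -
  have "ext \<beta> r \<in> W" if "r \<in> bilin_rel Y X" for r
    using that unfolding bilin_rel_def
    by (rule ext_in_subspace[OF _ W]) (auto simp: ext_diff ext_scaleC ext_pair assms)
  then have "ext \<beta> (f - g) \<in> W"
    using \<open>f \<doteq> g\<close> unfolding cong_def unfolding R_def
    by (elim ext_in_subspace[OF _ W]) (auto simp: balanced_gens_def ext_diff ext_pair assms)
  then show ?thesis
    by (simp add: ext_diff)
qed

end

section \<open>Isometric morphisms and the induced operator\<close>

locale morphism = src: balanced Y m X k + tgt: balanced Z n X k
  for Y :: "'y::complex_normed_vector set" and m :: "'y \<Rightarrow> ('l::complex_normed_vector \<Rightarrow>\<^sub>L 'l) \<Rightarrow> 'y"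
    and Z :: "'z::complex_normed_vector set" and n :: "'z \<Rightarrow> ('l \<Rightarrow>\<^sub>L 'l) \<Rightarrow> 'z"
    and X :: "'x::complex_normed_vector set" and k :: "('l \<Rightarrow>\<^sub>L 'l) \<Rightarrow> 'x \<Rightarrow> 'x" +
  fixes \<alpha> :: "'y \<Rightarrow> 'z"
  assumes morphism: "right_morphism Y m Z n \<alpha>" and isometric: "y \<in> Y \<Longrightarrow> norm (\<alpha> y) = norm y"
begin

lemma \<alpha>_closed: "y \<in> Y \<Longrightarrow> \<alpha> y \<in> Z"
  and \<alpha>_add: "y \<in> Y \<Longrightarrow> y' \<in> Y \<Longrightarrow> \<alpha> (y + y') = \<alpha> y + \<alpha> y'"
  and \<alpha>_scaleC: "y \<in> Y \<Longrightarrow> \<alpha> (c *\<^sub>C y) = c *\<^sub>C \<alpha> y"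
  and \<alpha>_m: "a \<in> bops \<Longrightarrow> y \<in> Y \<Longrightarrow> \<alpha> (m y a) = n (\<alpha> y) a"
  using morphism unfolding right_morphism_def by blast+

lemma \<alpha>_zero: "\<alpha> 0 = 0"
  using \<alpha>_scaleC[of 0 0] cvec.subspace_0[OF src.right_subspace] by simp

lemma \<alpha>_injective:
  assumes "y \<in> Y" "y' \<in> Y" "\<alpha> y = \<alpha> y'"
  shows "y = y'"
proof -
  have "\<alpha> (y + (-1) *\<^sub>C y') = \<alpha> y + (-1) *\<^sub>C \<alpha> y'"
    using assms by (simp only: \<alpha>_add \<alpha>_scaleC cvec.subspace_scale[OF src.right_subspace])
  then have "\<alpha> (y + (-1) *\<^sub>C y') = 0"
    using assms(3) by (simp add: scaleC_minus_one)
  moreover have "y + (-1) *\<^sub>C y' \<in> Y"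
    by (intro cvec.subspace_add[OF src.right_subspace] cvec.subspace_scale[OF src.right_subspace] assms)
  ultimately have "norm (y + (-1) *\<^sub>C y') = 0"
    using isometric by fastforce
  then show ?thesis
    by (simp add: scaleC_minus_one)
qed

lemma image_subspace: "csubspace (\<alpha> ` Y)"
proof (rule cvec.subspaceI)
  show "0 \<in> \<alpha> ` Y"
    using \<alpha>_zero cvec.subspace_0[OF src.right_subspace] by (metis imageI)
  show "z + z' \<in> \<alpha> ` Y" if "z \<in> \<alpha> ` Y" "z' \<in> \<alpha> ` Y" for z z'
    using that \<alpha>_add cvec.subspace_add[OF src.right_subspace] by (metis (no_types, lifting) imageE imageI)
  show "c *\<^sub>C z \<in> \<alpha> ` Y" if "z \<in> \<alpha> ` Y" for c z
    using that \<alpha>_scaleC cvec.subspace_scale[OF src.right_subspace] by (metis (no_types, lifting) imageE imageI)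
qed

lemma push_formals: "f \<in> formals Y X \<Longrightarrow> push \<alpha> f \<in> formals Z X"
  unfolding push_eq_ext
  by (erule ext_in[OF _ formals_subspace]) (auto intro: pair_in_formals \<alpha>_closed)

lemma push_cong:
  assumes "src.cong f g"
  shows "tgt.cong (push \<alpha> f) (push \<alpha> g)"
proof -
  have "push \<alpha> f - push \<alpha> g \<in> tgt.R"
    unfolding push_eq_ext
    by (rule src.ext_cong[OF tgt.V _ _ _ _ _ assms])
      (auto simp: \<alpha>_add \<alpha>_scaleC \<alpha>_m diff_diff_eq \<alpha>_closed simp flip: tgt.cong_def
        intro: tgt.cong_add_left tgt.cong_add_right tgt.cong_scaleC_left tgt.cong_scaleC_right
          tgt.cong_balanced)
  then show ?thesis
    by (simp add: tgt.cong_def)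
qed

lemma push_formal: "push \<alpha> (formal ps) = formal (map (\<lambda>(y, x). (\<alpha> y, x)) ps)"
  unfolding push_eq_ext by (induction ps) (auto simp: ext_zero ext_add ext_pair)

lemma seminorm_push_le:
  assumes "f \<in> formals Y X"
  shows "tgt.seminorm (push \<alpha> f) \<le> src.seminorm f"
proof (rule field_le_epsilon)
  fix e :: real
  assume "0 < e"
  then obtain ps where ps: "set ps \<subseteq> Y \<times> X" "src.cong (formal ps) f" "cost ps < src.seminorm f + e"
    using src.seminorm_less[OF assms, of "src.seminorm f + e"] by auto
  have "set (map (\<lambda>(y, x). (\<alpha> y, x)) ps) \<subseteq> Z \<times> X"
    using ps(1) \<alpha>_closed by auto
  then have "tgt.seminorm (push \<alpha> f) \<le> cost (map (\<lambda>(y, x). (\<alpha> y, x)) ps)"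
    using push_cong[OF ps(2)] by (intro tgt.seminorm_le) (simp_all add: push_formal)
  also have "\<dots> = cost ps"
    using ps(1) by (induction ps) (auto simp: isometric)
  finally show "tgt.seminorm (push \<alpha> f) \<le> src.seminorm f + e"
    using ps(3) by simp
qed

text \<open>Justifies \<open>the_elem\<close> in \<open>mod_tensor_map\<close>: representatives of
  one class differ by null elements, and \<open>push \<alpha>\<close> does not increase the
  seminorm, so all images have the same class.\<close>

lemma mod_tensor_map_class:
  assumes "f \<in> formals Y X"
  shows "mod_tensor_map Z n X k \<alpha> (mod_tensor_class Y m X k f) = mod_tensor_class Z n X k (push \<alpha> f)"
proof -
  have "mod_tensor_class Z n X k (push \<alpha> g) = mod_tensor_class Z n X k (push \<alpha> f)"
    if "g \<in> \<Union> (mod_tensor_class Y m X k f)" for g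
  proof (rule tgt.mod_tensor_class_eqI)
    note g = src.Union_mod_tensor_class[OF assms that]
    have eq: "push \<alpha> g - push \<alpha> f = push \<alpha> (g - f)"
      by (simp add: push_eq_ext ext_diff)
    show formals: "push \<alpha> g - push \<alpha> f \<in> formals Z X"
      unfolding eq by (rule push_formals[OF g(1)])
    show "tgt.seminorm (push \<alpha> g - push \<alpha> f) = 0"
      using seminorm_push_le[OF g(1)] tgt.seminorm_nonneg[OF formals] g(2) by (simp add: eq)
  qed
  moreover have "f \<in> \<Union> (mod_tensor_class Y m X k f)"
    using src.mem_mod_tensor_class[of "tensor_class Y X f" f] cvec.subspace_0[OF formals_subspace]
      src.seminorm_zero src.mem_tensor_class[of f f] by force
  ultimately have "(\<lambda>g. mod_tensor_class Z n X k (push \<alpha> g)) ` \<Union> (mod_tensor_class Y m X k f) =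
      {mod_tensor_class Z n X k (push \<alpha> f)}"
    by blast
  then show ?thesis
    by (simp add: mod_tensor_map_def)
qed

end


section \<open>Flatness\<close>

lemma cspan_orthogonal:
  assumes "x \<in> cspan A" "y \<in> cspan B" "\<And>a b. a \<in> A \<Longrightarrow> b \<in> B \<Longrightarrow> cinner a b = 0"
  shows "cinner x y = 0"
proof -
  have "cinner a y = 0" if "a \<in> A" for a
    using assms(2) by (induction rule: cvec.span_induct_alt)
      (simp_all add: cinner_add_right cinner_scaleC_right assms(3) that)
  with assms(1) show ?thesis
    by (induction rule: cvec.span_induct_alt) (simp_all add: cinner_add_left cinner_scaleC_left)
qed

text \<open>Makes \<open>proj E\<close> a right support of every product
  \<open>m y (pisom E \<phi>)\<close>.\<close>

lemma pisom_compose_proj: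
  assumes "finite E" "orthonormal E"
  shows "pisom E \<phi> o\<^sub>L proj E = pisom E \<phi>"
proof (rule blinfun_eqI)
  fix x
  have "cinner (blinfun_apply (proj E) x) e = cinner x e" if "e \<in> E" for e
    using projection_proj[OF assms] proj_apply_cspan[OF assms] cvec.span_base[OF that]
    by (simp add: projection_def)
  then show "blinfun_apply (pisom E \<phi> o\<^sub>L proj E) x = blinfun_apply (pisom E \<phi>) x"
    unfolding blinfun_apply_blinfun_compose pisom_apply[of E \<phi>] by simp
qed

text \<open>The carrier \<open>X\<close> lies anywhere between the algebraic and the completed
  tensor product, so that the two modules of the theorem are treated at once.\<close>

locale htensor_balanced = htensor t + balanced Y m X "hilbert_tensor_action t"
  for t :: "'l::chilbert_space \<Rightarrow> 'h::chilbert_space \<Rightarrow> 't::chilbert_space"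
    and Y :: "'y::complex_normed_vector set" and m X +
  assumes alg_subset: "alg_hilbert_tensor t \<subseteq> X"
begin

lemma trunc_space_subset: "trunc_space S \<subseteq> X"
  using trunc_space_subset_alg alg_subset by blast

text \<open>
  The supports of the two summands are moved to orthogonal finite-dimensional subspaces
  by a partial isometry; this is possible since the first factor is infinite-dimensional.
\<close>

lemma merge_two:
  assumes semi: "right_semi_Ruan Y m" and inf: "\<not> (\<exists>B :: 'l set. finite B \<and> cspan B = UNIV)"
    and S: "finite S" "orthonormal S"
    and x: "x1 \<in> trunc_space S" "x2 \<in> trunc_space S" and y: "y1 \<in> Y" "y2 \<in> Y"
  obtains y x where "y \<in> Y" "x \<in> trunc_space S" "pair y1 x1 + pair y2 x2 \<doteq> pair y x"
    "(norm y)\<^sup>2 \<le> (norm y1)\<^sup>2 + (norm y2)\<^sup>2" "(norm x)\<^sup>2 \<le> (norm x1)\<^sup>2 + (norm x2)\<^sup>2"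
proof -
  obtain A where A: "finite A" "orthonormal A" "(\<lambda>h. slice h x1) ` S \<subseteq> cspan A"
    using gram_schmidt[of "(\<lambda>h. slice h x1) ` S"] S(1) by (metis finite_imageI)
  obtain B where B: "finite B" "orthonormal B" "(\<lambda>h. slice h x2) ` S \<subseteq> cspan B"
    using gram_schmidt[of "(\<lambda>h. slice h x2) ` S"] S(1) by (metis finite_imageI)
  \<comment> \<open>A copy of \<open>B\<close> orthogonal to \<open>A\<close>, however
    \<open>B\<close> lies relative to \<open>A\<close>.\<close>
  obtain E where E: "finite E" "card E = card B" "A \<inter> E = {}" "orthonormal (A \<union> E)"
    using orthonormal_extend[OF inf A(1,2)] by blast
  have onE: "orthonormal E"
    using E(4) by (rule orthonormal_subset) simp
  have orth: "cinner a e = 0" "cinner e a = 0" if "a \<in> A" "e \<in> E" for a e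
    using that E(3) orthonormalD[OF E(4)] by auto
  obtain \<phi> where "bij_betw \<phi> B E"
    using finite_same_card_bij[OF B(1) E(1)] E(2) by auto
  then have \<phi>: "inj_on \<phi> B" "\<phi> ` B = E"
    by (auto simp: bij_betw_def)
  \<comment> \<open>\<open>U\<close> carries the first leg of \<open>x2\<close> into the span of
    \<open>E\<close>; its adjoint \<open>V\<close> brings it back.\<close>
  define U where "U = pisom B \<phi>"
  define V where "V = pisom E (inv_into B \<phi>)"
  have inv: "inj_on (inv_into B \<phi>) E" "inv_into B \<phi> ` E = B"
    using \<phi> inv_into_image_cancel[OF \<phi>(1)] inj_on_inv_into[of E \<phi> B] by auto
  have ops [simp]: "U \<in> bops" "V \<in> bops"
    by (simp_all add: U_def V_def)
  have norms: "norm U \<le> 1" "norm V \<le> 1" "norm (proj A) \<le> 1"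
    unfolding U_def V_def using A B E onE \<phi> inv by (auto intro!: norm_pisom_le)
  have sx1: "slice g x1 \<in> cspan A" for g
    using x(1) A(3) by (rule slices_in_span)
  have sx2: "slice g x2 \<in> cspan B" for g
    using x(2) B(3) by (rule slices_in_span)
  have U_in: "blinfun_apply U v \<in> cspan E" for v
    using pisom_in_cspan[of B \<phi> v] by (simp add: U_def \<phi>)
  have VU: "blinfun_apply V (blinfun_apply U v) = v" if "v \<in> cspan B" for v
  proof -
    have "V o\<^sub>L U = proj B"
      using pisom_inv[OF B(1) _ \<phi>(1)] onE by (simp add: U_def V_def \<phi>(2))
    then show ?thesis
      using proj_apply_cspan[OF B(1,2) that] by (metis blinfun_apply_blinfun_compose)
  qed
  have proj_E: "blinfun_apply (proj A) v = 0" if "v \<in> cspan E" for v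
    using that orth by (intro pisom_eq_0)
  \<comment> \<open>Expanding \<open>pair y x\<close> for the \<open>y\<close> and \<open>x\<close>
    chosen below gives four terms; by these identities the mixed ones vanish and the other two are
    the original summands.\<close>
  have acts: "act (proj A) x1 = x1" "act (proj A) (act U x2) = 0" "act V x1 = 0" "act V (act U x2) = x2"
    using sx1 sx2 U_in orth
    by (auto intro!: eq_if_slice_eq pisom_eq_0[where A = A] simp: slice_act proj_apply_cspan[OF A(1,2)] proj_E VU V_def[symmetric])
      (auto simp: V_def intro!: pisom_eq_0[where A = A])
  define y where "y = m y1 (proj A) + m y2 V"
  define x where "x = x1 + act U x2"
  have Ux2: "act U x2 \<in> trunc_space S"
    using x(2) by (simp add: act_trunc_space)
  note in_X = subsetD[OF trunc_space_subset]
  have X: "x1 \<in> X" "x2 \<in> X" "act U x2 \<in> X"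
    using x Ux2 in_X by auto
  have closed: "m y1 (proj A) \<in> Y" "m y2 V \<in> Y"
    using y by (simp_all add: m_closed)
  show thesis
  proof
    show "y \<in> Y"
      unfolding y_def using closed by (rule cvec.subspace_add[OF right_subspace])
    show xS: "x \<in> trunc_space S"
      unfolding x_def using x(1) Ux2 by (rule cvec.subspace_add[OF subspace_trunc_space])
    have "pair y x \<doteq> pair (m y1 (proj A)) x + pair (m y2 V) x"
      unfolding y_def using closed xS in_X by (intro cong_add_left) auto
    also have "\<dots> \<doteq> (pair (m y1 (proj A)) x1 + pair (m y1 (proj A)) (act U x2)) +
        (pair (m y2 V) x1 + pair (m y2 V) (act U x2))"
      unfolding x_def using closed X by (intro cong_add cong_add_right)
    also have "\<dots> \<doteq> (pair y1 (act (proj A) x1) + pair y1 (act (proj A) (act U x2))) +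
        (pair y2 (act V x1) + pair y2 (act V (act U x2)))"
      using y X by (intro cong_add cong_balanced) simp_all
    also have "\<dots> \<doteq> (pair y1 x1 + 0) + (0 + pair y2 x2)"
      unfolding acts using y by (intro cong_add cong_refl cong_zero_right)
    finally show "pair y1 x1 + pair y2 x2 \<doteq> pair y x"
      by (simp add: cong_sym)
    have PQ: "proj A o\<^sub>L proj E = 0"
      using pisom_in_cspan[of E "\<lambda>x. x"] by (intro blinfun_eqI) (simp add: proj_E)
    have "right_support m (proj A) (m y1 (proj A))" "right_support m (proj E) (m y2 V)"
      using y pisom_compose_proj[OF A(1,2)] pisom_compose_proj[OF E(1) onE]
      by (simp_all add: right_support_def projection_proj A E onE V_def flip: m_compose)
    then have "norm y \<le> sqrt ((norm (m y1 (proj A)))\<^sup>2 + (norm (m y2 V))\<^sup>2)"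
      unfolding y_def using semi closed PQ unfolding right_semi_Ruan_def by blast
    then have "(norm y)\<^sup>2 \<le> (norm (m y1 (proj A)))\<^sup>2 + (norm (m y2 V))\<^sup>2"
      using power_mono[of "norm y" _ 2] by fastforce
    also have "\<dots> \<le> (norm y1)\<^sup>2 + (norm y2)\<^sup>2"
      using y norms by (intro add_mono power_mono norm_m_le_contraction) simp_all
    finally show "(norm y)\<^sup>2 \<le> (norm y1)\<^sup>2 + (norm y2)\<^sup>2" .
    \<comment> \<open>On \<open>trunc_space S\<close> inner products are computed slice by slice,
      and the slices lie in the orthogonal spans of \<open>A\<close> and \<open>E\<close>.\<close>
    have "cinner x1 (act U x2) = cinner x1 (trunc S (act U x2))"
      using Ux2 by (simp add: trunc_space_def)
    also have "\<dots> = 0"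
      unfolding cinner_trunc
      by (intro sum.neutral ballI cspan_orthogonal[OF sx1 _ orth(1)]) (simp_all add: slice_act U_in)
    finally have "(norm x)\<^sup>2 = (norm x1)\<^sup>2 + (norm (act U x2))\<^sup>2"
      unfolding x_def by (rule norm_add_orthogonal)
    moreover have "norm (act U x2) \<le> norm x2"
      using norm_act_le[of U x2] mult_right_mono[OF norms(1), of "norm x2"] by simp
    ultimately show "(norm x)\<^sup>2 \<le> (norm x1)\<^sup>2 + (norm x2)\<^sup>2"
      by simp
  qed
qed

text \<open>For nonzero factors, multiply \<open>y\<close> and divide \<open>x\<close> by the square
  root of \<open>norm x / norm y\<close>; otherwise the tensor is congruent to
  \<open>pair 0 0\<close>. The subspace \<open>W\<close> keeps the second factor in the truncated
  space.\<close>

lemma equalize_norms: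
  assumes "y \<in> Y" "x \<in> W" "csubspace W" "W \<subseteq> X"
  obtains y' x' where "y' \<in> Y" "x' \<in> W" "pair y x \<doteq> pair y' x'"
    "(norm y')\<^sup>2 \<le> norm y * norm x" "(norm x')\<^sup>2 \<le> norm y * norm x"
proof (cases "y = 0 \<or> x = 0")
  case True
  then have "pair y x \<doteq> 0"
    using assms cong_zero_left cong_zero_right by blast
  also have "0 \<doteq> pair 0 0"
    using cong_zero_left[of 0] cvec.subspace_0[OF left_subspace] by (simp add: cong_sym)
  finally show thesis
    using that[of 0 0] cvec.subspace_0[OF right_subspace] cvec.subspace_0[OF assms(3)] by simp
next
  case False
  define r where "r = sqrt (norm x / norm y)"
  have r: "0 < r" "r\<^sup>2 = norm x / norm y"
    using False by (simp_all add: r_def)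
  define c where "c = complex_of_real r"
  have c: "c \<noteq> 0" "cmod c = r"
    using r by (simp_all add: c_def)
  have W: "inverse c *\<^sub>C x \<in> W"
    using assms by (simp add: cvec.subspace_scale)
  have "pair (c *\<^sub>C y) (inverse c *\<^sub>C x) \<doteq> c *\<^sub>C pair y (inverse c *\<^sub>C x)"
    using assms W by (intro cong_scaleC_left) auto
  also have "\<dots> \<doteq> c *\<^sub>C inverse c *\<^sub>C pair y x"
    using assms by (intro cong_scaleC cong_scaleC_right) auto
  finally have "pair y x \<doteq> pair (c *\<^sub>C y) (inverse c *\<^sub>C x)"
    using c by (simp add: scaleC_scaleC scaleC_one cong_sym)
  moreover have "(norm (c *\<^sub>C y))\<^sup>2 = norm y * norm x"
    using False by (simp add: norm_scaleC c power_mult_distrib r) (simp add: power2_eq_square)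
  moreover have "(norm (inverse c *\<^sub>C x))\<^sup>2 = norm y * norm x"
    using False by (simp add: norm_scaleC norm_inverse c power_mult_distrib power_inverse r)
      (simp add: power2_eq_square field_simps)
  ultimately show thesis
    using W assms(1) by (intro that) (auto intro: cvec.subspace_scale[OF right_subspace])
qed

text \<open>The induction bounds both squared norms by \<open>cost ps\<close>, which is additive
  along the list, instead of the product of the norms, which is not.\<close>

lemma merge:
  assumes "right_semi_Ruan Y m" "\<not> (\<exists>B :: 'l set. finite B \<and> cspan B = UNIV)"
    and S: "finite S" "orthonormal S" and "set ps \<subseteq> Y \<times> trunc_space S"
  shows "\<exists>y\<in>Y. \<exists>x\<in>trunc_space S. formal ps \<doteq> pair y x \<and> (norm y)\<^sup>2 \<le> cost ps \<and> (norm x)\<^sup>2 \<le> cost ps"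
  using assms(5)
proof (induction ps)
  case Nil
  have "0 \<doteq> pair 0 0"
    using cong_zero_left[of 0] cvec.subspace_0[OF left_subspace] by (simp add: cong_sym)
  then show ?case
    using cvec.subspace_0[OF right_subspace] cvec.subspace_0[OF subspace_trunc_space]
    by (intro bexI[of _ 0]) simp_all
next
  case (Cons p ps)
  obtain y1 x1 where p: "p = (y1, x1)"
    by (cases p)
  then have 1: "y1 \<in> Y" "x1 \<in> trunc_space S"
    using Cons.prems by auto
  obtain y2 x2 where 2: "y2 \<in> Y" "x2 \<in> trunc_space S" "formal ps \<doteq> pair y2 x2"
    "(norm y2)\<^sup>2 \<le> cost ps" "(norm x2)\<^sup>2 \<le> cost ps"
    using Cons by auto
  obtain y1' x1' where 3: "y1' \<in> Y" "x1' \<in> trunc_space S" "pair y1 x1 \<doteq> pair y1' x1'"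
    "(norm y1')\<^sup>2 \<le> norm y1 * norm x1" "(norm x1')\<^sup>2 \<le> norm y1 * norm x1"
    using equalize_norms[OF 1 subspace_trunc_space trunc_space_subset] .
  obtain y x where yx: "y \<in> Y" "x \<in> trunc_space S" "pair y1' x1' + pair y2 x2 \<doteq> pair y x"
    "(norm y)\<^sup>2 \<le> (norm y1')\<^sup>2 + (norm y2)\<^sup>2" "(norm x)\<^sup>2 \<le> (norm x1')\<^sup>2 + (norm x2)\<^sup>2"
    using merge_two[OF assms(1,2) S 3(2) 2(2) 3(1) 2(1)] .
  have "formal (p # ps) \<doteq> pair y1' x1' + pair y2 x2"
    using p 2(3) 3(3) by (simp add: cong_add)
  also note yx(3)
  finally show ?case
    using yx 2 3 p by (intro bexI[of _ y] bexI[of _ x]) auto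
qed

text \<open>
  For a unit vector \<open>e\<close> the map \<open>y \<otimes> \<zeta> \<mapsto> y \<cdot> (\<zeta>\<^sub>h \<otimes> e\<^sup>*)\<close> with \<open>\<zeta>\<^sub>h = slice h \<zeta>\<close> is balanced. Together
  these maps, for \<open>h\<close> in an orthonormal set, are the coordinates of a balanced tensor.
\<close>

definition coord :: "'l \<Rightarrow> 'h \<Rightarrow> ('y, 't) formal \<Rightarrow> 'y" where
  "coord e h = ext (\<lambda>y \<zeta>. m y (rank1 (slice h \<zeta>) e))"

lemma coord_pair: "coord e h (pair y \<zeta>) = m y (rank1 (slice h \<zeta>) e)"
  by (simp add: coord_def ext_pair)

lemma coord_in: "f \<in> formals Y X \<Longrightarrow> coord e h f \<in> Y"
  unfolding coord_def by (erule ext_in[OF _ right_subspace]) (simp add: m_closed)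

text \<open>Compatibility with the balancing relations is the identity
  \<open>a o\<^sub>L rank1 \<xi> e = rank1 (a \<xi>) e\<close> combined with the fact that slices
  commute with the action.\<close>

lemma coord_cong:
  assumes "f \<doteq> g"
  shows "coord e h f = coord e h g"
proof -
  have "coord e h f - coord e h g \<in> {0}"
    unfolding coord_def
    by (rule ext_cong[OF _ _ _ _ _ _ assms])
      (simp_all add: cvec.subspace_single_0 m_add slice_add rank1_add_left m_add_op m_scaleC
        slice_scaleC rank1_scaleC_left m_scaleC_op slice_act compose_rank1 flip: m_compose)
  then show ?thesis
    by simp
qed

text \<open>Since \<open>e\<close> is a unit vector, \<open>t \<xi> h\<close> equals
  \<open>act (rank1 \<xi> e) (t e h)\<close>, and the operator can be moved to the left factor.
  Hence the coordinates along \<open>S\<close> determine the class modulo \<open>R\<close>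
  exactly.\<close>

lemma cong_coords:
  assumes "cinner e e = 1" "f \<in> formals Y (trunc_space S)"
  shows "f \<doteq> (\<Sum>h\<in>S. pair (coord e h f) (t e h))"
  using assms(2)
proof (induction rule: formals_induct)
  case zero
  have "(\<Sum>h\<in>S. 0) \<doteq> (\<Sum>h\<in>S. pair (coord e h 0) (t e h))"
    using t_in_alg alg_subset
    unfolding coord_def ext_zero by (intro cong_sum cong_sym[OF cong_zero_left]) auto
  then show ?case
    by simp
next
  case (step c y \<zeta> g)
  have teh: "t e h \<in> X" and X: "t \<xi> h \<in> X" for h \<xi>
    using t_in_alg alg_subset by auto
  have g: "coord e h g \<in> Y" for h
    using step(3) formals_mono[OF trunc_space_subset] by (intro coord_in) auto
  have "pair y \<zeta> = pair y (\<Sum>h\<in>S. t (slice h \<zeta>) h)"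
    using trunc_space_eq[OF step(2)] by simp
  also have "\<dots> \<doteq> (\<Sum>h\<in>S. pair y (t (slice h \<zeta>) h))"
    using step(1) X by (intro cong_sum_right)
  also have "(\<Sum>h\<in>S. pair y (t (slice h \<zeta>) h)) = (\<Sum>h\<in>S. pair y (act (rank1 (slice h \<zeta>) e) (t e h)))"
    by (simp add: act_t assms(1) scaleC_one)
  also have "\<dots> \<doteq> (\<Sum>h\<in>S. pair (coord e h (pair y \<zeta>)) (t e h))"
    unfolding coord_pair using step(1) teh by (intro cong_sum cong_sym[OF cong_balanced]) simp_all
  finally have "c *\<^sub>C pair y \<zeta> + g \<doteq>
      c *\<^sub>C (\<Sum>h\<in>S. pair (coord e h (pair y \<zeta>)) (t e h)) + (\<Sum>h\<in>S. pair (coord e h g) (t e h))"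
    using step(4) by (intro cong_add cong_scaleC)
  also have "\<dots> = (\<Sum>h\<in>S. c *\<^sub>C pair (coord e h (pair y \<zeta>)) (t e h) + pair (coord e h g) (t e h))"
    by (simp add: cvec.scale_sum_right sum.distrib)
  also have "\<dots> \<doteq> (\<Sum>h\<in>S. pair (coord e h (c *\<^sub>C pair y \<zeta> + g)) (t e h))"
  proof (rule cong_sum, rule cong_sym)
    fix h
    have y: "coord e h (pair y \<zeta>) \<in> Y"
      using step(1) by (simp add: coord_pair m_closed)
    have "pair (c *\<^sub>C coord e h (pair y \<zeta>) + coord e h g) (t e h) \<doteq>
        pair (c *\<^sub>C coord e h (pair y \<zeta>)) (t e h) + pair (coord e h g) (t e h)"
      using y g teh by (intro cong_add_left) (auto intro: cvec.subspace_scale[OF right_subspace])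
    also have "\<dots> \<doteq> c *\<^sub>C pair (coord e h (pair y \<zeta>)) (t e h) + pair (coord e h g) (t e h)"
      using y teh by (intro cong_add cong_scaleC_left cong_refl)
    finally show "pair (coord e h (c *\<^sub>C pair y \<zeta> + g)) (t e h) \<doteq>
        c *\<^sub>C pair (coord e h (pair y \<zeta>)) (t e h) + pair (coord e h g) (t e h)"
      by (simp add: coord_def ext_add ext_scaleC)
  qed
  finally show ?case .
qed

lemma approx_alg:
  assumes "f \<in> formals Y X"
  shows "\<forall>e>0. \<exists>g\<in>formals Y (alg_hilbert_tensor t). seminorm (f - g) < e"
  using assms
proof (induction rule: formals_induct)
  case zero
  show ?case
    using cvec.subspace_0[OF formals_subspace] seminorm_zero by (intro allI impI bexI[of _ 0]) auto
next
  case (step c y x f)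
  show ?case
  proof (intro allI impI)
    fix e :: real
    assume "0 < e"
    \<comment> \<open>Chosen so that the error \<open>cmod c * norm y * d\<close> of the new summand
      is at most \<open>e / 2\<close>; the added 1 avoids division by zero.\<close>
    define d where "d = e / (2 * (cmod c * norm y + 1))"
    have pos: "0 < cmod c * norm y + 1"
      by (simp add: add_nonneg_pos)
    then have "0 < d"
      using \<open>0 < e\<close> by (simp add: d_def)
    moreover have "x \<in> closure (alg_hilbert_tensor t)"
      using t_dense by (simp add: alg_hilbert_tensor_def)
    ultimately obtain x' where x': "x' \<in> alg_hilbert_tensor t" "norm (x - x') < d"
      unfolding closure_approachable by (auto simp: dist_norm norm_minus_commute)
    obtain g where g: "g \<in> formals Y (alg_hilbert_tensor t)" "seminorm (f - g) < e / 2"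
      using step.IH \<open>0 < e\<close> by (meson half_gt_zero)
    have gX: "g \<in> formals Y X"
      using g(1) formals_mono[OF alg_subset] by blast
    have xx': "x - x' \<in> X" "x' \<in> X"
      using step.hyps x'(1) alg_subset left_subspace by (auto intro: cvec.subspace_diff)
    let ?g = "c *\<^sub>C pair y x' + g"
    have "?g \<in> formals Y (alg_hilbert_tensor t)"
      using step.hyps(1) x'(1) g(1) formals_subspace
      by (auto intro!: cvec.subspace_add cvec.subspace_scale pair_in_formals)
    moreover have "seminorm (c *\<^sub>C pair y x + f - ?g) < e"
    proof -
      have "pair y x - pair y x' \<doteq> pair y (x - x')"
        using cong_add_right[OF step.hyps(1) xx'] by (simp add: cong_def algebra_simps)
      then have "c *\<^sub>C (pair y x - pair y x') + (f - g) \<doteq> c *\<^sub>C pair y (x - x') + (f - g)"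
        by (intro cong_add cong_scaleC cong_refl)
      then have "seminorm (c *\<^sub>C pair y x + f - ?g) = seminorm (c *\<^sub>C pair y (x - x') + (f - g))"
        by (subst seminorm_cong[symmetric]) (simp_all add: cvec.scale_right_diff_distrib algebra_simps)
      also have "\<dots> \<le> seminorm (c *\<^sub>C pair y (x - x')) + seminorm (f - g)"
        using step.hyps xx' gX formals_subspace
        by (intro seminorm_add_le) (auto intro: cvec.subspace_diff cvec.subspace_scale pair_in_formals)
      also have "seminorm (c *\<^sub>C pair y (x - x')) \<le> cmod c * (norm y * norm (x - x'))"
        using step.hyps(1) xx' seminorm_scaleC_le[OF pair_in_formals, of y "x - x'" c]
          mult_left_mono[OF seminorm_pair_le, of y "x - x'" "cmod c"] by simp
      also have "\<dots> = (cmod c * norm y) * norm (x - x')"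
        by simp
      also have "\<dots> \<le> (cmod c * norm y + 1) * d"
        using x'(2) by (intro mult_mono) auto
      also have "\<dots> = e / 2"
        using pos by (simp add: d_def field_simps)
      finally show ?thesis
        using g(2) by simp
    qed
    ultimately show "\<exists>g\<in>formals Y (alg_hilbert_tensor t). seminorm (c *\<^sub>C pair y x + f - g) < e"
      by blast
  qed
qed

end

section \<open>Comparison of the two seminorms\<close>

locale htensor_morphism = htensor t + morphism Y m Z n X "hilbert_tensor_action t" \<alpha>
  for t :: "'l::chilbert_space \<Rightarrow> 'h::chilbert_space \<Rightarrow> 't::chilbert_space"
    and Y :: "'y::complex_normed_vector set" and m
    and Z :: "'z::complex_normed_vector set" and n X \<alpha> +
  assumes alg_subset: "alg_hilbert_tensor t \<subseteq> X"
    and semi_Ruan: "right_semi_Ruan Z n"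
    and infinite_dim: "\<not> (\<exists>B :: 'l set. finite B \<and> cspan B = UNIV)"
begin

sublocale src: htensor_balanced t Y m X
  by unfold_locales (rule alg_subset)

sublocale tgt: htensor_balanced t Z n X
  by unfold_locales (rule alg_subset)

lemma coord_push:
  assumes "f \<in> formals Y X"
  shows "tgt.coord e h (push \<alpha> f) = \<alpha> (src.coord e h f)"
  using assms
proof (induction rule: formals_induct)
  case (step c y x g)
  then show ?case
    using src.coord_in[of g e h] src.m_closed[of "rank1 (slice h x) e" y]
    by (simp add: push_eq_ext src.coord_def tgt.coord_def ext_add ext_scaleC ext_pair \<alpha>_add \<alpha>_scaleC
        \<alpha>_m cvec.subspace_scale[OF src.right_subspace])
qed (simp add: push_eq_ext src.coord_def tgt.coord_def ext_zero \<alpha>_zero)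

text \<open>
  The element \<open>z\<close> of the larger module can be replaced by \<open>z \<cdot> q\<close>, where \<open>q\<close> is the finite-rank
  projection onto the first leg of \<open>x\<close>; this element comes from the smaller module.
\<close>

lemma pull_back:
  assumes S: "finite S" and f: "f \<in> formals Y (trunc_space S)"
    and z: "z \<in> Z" and x: "x \<in> trunc_space S" and e: "cinner e e = 1"
    and coords: "\<And>h. h \<in> S \<Longrightarrow> tgt.coord e h (pair z x) = tgt.coord e h (push \<alpha> f)"
  obtains y where "y \<in> Y" "norm y \<le> norm z" "src.cong (pair y x) f"
proof -
  have fX: "f \<in> formals Y X"
    using f formals_mono[OF src.trunc_space_subset] by blast
  define F where "F = (\<lambda>h. slice h x) ` S"
  have "finite F"
    using S by (simp add: F_def)
  then obtain A where A: "finite A" "orthonormal A" "F \<subseteq> cspan A" "A \<subseteq> cspan F"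
    by (rule gram_schmidt)
  have coords': "n z (rank1 (slice h x) e) = \<alpha> (src.coord e h f)" if "h \<in> S" for h
    using coords[OF that] by (simp add: tgt.coord_pair coord_push[OF fX])
  \<comment> \<open>The expression is linear in \<open>\<xi>\<close>, and at the slices in
    \<open>F\<close> it is the image under \<open>\<alpha>\<close> of a coordinate of
    \<open>f\<close>.\<close>
  have image: "n z (rank1 \<xi> e) \<in> \<alpha> ` Y" if "\<xi> \<in> cspan F" for \<xi>
    using that
  proof (induction rule: cvec.span_induct_alt)
    case base
    have "rank1 0 e = 0"
      by (rule blinfun_eqI) (simp add: cvec.scale_zero_right)
    then show ?case
      using z cvec.subspace_0[OF image_subspace] by (simp add: tgt.m_zero_op)
  next
    case (step c b \<xi>)
    have "n z (rank1 b e) \<in> \<alpha> ` Y"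
      using step(1) coords' src.coord_in[OF fX] by (auto simp: F_def)
    then show ?case
      using step z by (simp add: rank1_add_left rank1_scaleC_left tgt.m_add_op tgt.m_scaleC_op bops_scaleC
          cvec.subspace_add[OF image_subspace] cvec.subspace_scale[OF image_subspace])
  qed
  \<comment> \<open>\<open>a\<close> is a combination of slices because
    \<open>A \<subseteq> cspan F\<close>. Multiplying by \<open>rank1 e a\<close> trades
    \<open>e\<close> for \<open>a\<close> and stays in the image of \<open>\<alpha>\<close>, which
    is a submodule.\<close>
  have diag: "n z (rank1 a a) \<in> \<alpha> ` Y" if a: "a \<in> A" for a
  proof -
    have "n z (rank1 a e) \<in> \<alpha> ` Y"
      using A(4) a by (intro image) auto
    then obtain y where y: "y \<in> Y" "n z (rank1 a e) = \<alpha> y"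
      by auto
    have "rank1 a a = rank1 a e o\<^sub>L rank1 e a"
      using e by (simp add: compose_rank1 scaleC_one)
    then have "n z (rank1 a a) = \<alpha> (m y (rank1 e a))"
      using y z by (simp add: tgt.m_compose \<alpha>_m)
    then show ?thesis
      using y(1) by (simp add: src.m_closed)
  qed
  have "n z (pisom A' (\<lambda>x. x)) \<in> \<alpha> ` Y" if "A' \<subseteq> A" for A'
    using finite_subset[OF that A(1)] that
  proof (induction A' rule: finite_induct)
    case empty
    then show ?case
      using z cvec.subspace_0[OF image_subspace] by (simp add: pisom_def tgt.m_zero_op)
  next
    case (insert a A')
    then show ?case
      using z diag[of a]
      by (simp add: pisom_def tgt.m_add_op bops_sum cvec.subspace_add[OF image_subspace])
  qed
  then obtain y where y: "y \<in> Y" "n z (proj A) = \<alpha> y"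
    by auto
  have "norm y \<le> norm z"
    using isometric[OF y(1)] y(2) tgt.norm_m_le_contraction[of "proj A" z] z norm_pisom_le[OF A(1,2)] A(2)
    by simp
  \<comment> \<open>The comparison is made in \<open>Z\<close>, where \<open>proj A\<close> can be
    absorbed since it fixes the slices of \<open>x\<close>; injectivity of \<open>\<alpha>\<close>
    brings it back to \<open>Y\<close>.\<close>
  moreover have "src.coord e h (pair y x) = src.coord e h f" if "h \<in> S" for h
  proof (rule \<alpha>_injective)
    have "\<alpha> (src.coord e h (pair y x)) = n (n z (proj A)) (rank1 (slice h x) e)"
      using y by (simp add: src.coord_pair \<alpha>_m)
    also have "\<dots> = n z (rank1 (blinfun_apply (proj A) (slice h x)) e)"
      using z by (simp add: compose_rank1 flip: tgt.m_compose)
    also have "blinfun_apply (proj A) (slice h x) = slice h x"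
      using A(3) that by (intro proj_apply_cspan A(1,2)) (auto simp: F_def)
    finally show "\<alpha> (src.coord e h (pair y x)) = \<alpha> (src.coord e h f)"
      using coords'[OF that] by simp
    show "src.coord e h (pair y x) \<in> Y"
      using y(1) by (simp add: src.coord_pair src.m_closed)
  qed (rule src.coord_in[OF fX])
  then have "src.cong (pair y x) f"
    using src.cong_coords[OF e pair_in_formals[OF y(1) x]] src.cong_coords[OF e f]
      src.cong_trans src.cong_sym by (metis (no_types, lifting) sum.cong)
  ultimately show thesis
    using that y(1) by blast
qed

lemma seminorm_le_push_trunc:
  assumes S: "finite S" "orthonormal S" and f: "f \<in> formals Y (trunc_space S)"
  shows "src.seminorm f \<le> tgt.seminorm (push \<alpha> f)"
proof (rule field_le_epsilon)
  fix \<epsilon> :: real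
  assume "0 < \<epsilon>"
  obtain E :: "'l set" where "card E = 1" "orthonormal E"
    using orthonormal_extend[OF infinite_dim finite.emptyI, of 1] by (auto simp: orthonormal_def)
  then obtain e :: 'l where e: "cinner e e = 1"
    using orthonormalD by (metis card_1_singletonE singletonI)
  have fX: "f \<in> formals Y X"
    using f formals_mono[OF src.trunc_space_subset] by blast
  obtain ps where ps: "set ps \<subseteq> Z \<times> X" "tgt.cong (formal ps) (push \<alpha> f)"
    "cost ps < tgt.seminorm (push \<alpha> f) + \<epsilon>"
    using tgt.seminorm_less[OF push_formals[OF fX], of "tgt.seminorm (push \<alpha> f) + \<epsilon>"] \<open>0 < \<epsilon>\<close> by auto
  \<comment> \<open>The factors \<open>x\<close> may lie outside \<open>trunc_space S\<close>, where
    \<open>merge\<close> does not apply. From here on only coordinates along \<open>S\<close> are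
    compared, and truncation preserves these.\<close>
  define qs where "qs = map (\<lambda>(z, x). (z, trunc S x)) ps"
  have qs: "set qs \<subseteq> Z \<times> trunc_space S"
    using ps(1) trunc_in_trunc_space[OF S] by (auto simp: qs_def)
  have "cost qs \<le> cost ps"
    unfolding qs_def by (induction ps) (auto intro!: add_mono mult_left_mono norm_trunc_le[OF S])
  have coord_qs: "tgt.coord e h (formal qs) = tgt.coord e h (formal ps)" if "h \<in> S" for h
    unfolding qs_def
    by (induction ps) (auto simp: tgt.coord_def ext_zero ext_add ext_pair slice_trunc_mem[OF S that])
  obtain z x where zx: "z \<in> Z" "x \<in> trunc_space S" "tgt.cong (formal qs) (pair z x)"
    "(norm z)\<^sup>2 \<le> cost qs" "(norm x)\<^sup>2 \<le> cost qs"
    using tgt.merge[OF semi_Ruan infinite_dim S qs] by blast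
  have "tgt.coord e h (pair z x) = tgt.coord e h (push \<alpha> f)" if "h \<in> S" for h
    using tgt.coord_cong[OF zx(3)] tgt.coord_cong[OF ps(2)] coord_qs[OF that] by simp
  from pull_back[OF S(1) f zx(1,2) e this]
  obtain y where y: "y \<in> Y" "norm y \<le> norm z" "src.cong (pair y x) f" .
  have "src.seminorm f \<le> norm y * norm x"
    using src.seminorm_cong[OF y(3)] src.seminorm_pair_le[OF y(1), of x] zx(2) src.trunc_space_subset
    by auto
  also have "\<dots> \<le> norm z * norm x"
    using y(2) by (intro mult_right_mono) auto
  also have "\<dots> \<le> sqrt (cost qs) * sqrt (cost qs)"
    using zx(4,5) by (intro mult_mono real_le_rsqrt) (auto simp: cost_nonneg)
  also have "\<dots> \<le> cost ps"
    using \<open>cost qs \<le> cost ps\<close> cost_nonneg[of qs] by simp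
  finally show "src.seminorm f \<le> tgt.seminorm (push \<alpha> f) + \<epsilon>"
    using ps(3) by simp
qed

text \<open>The nontrivial inequality passes from \<open>g\<close> to \<open>f\<close> because
  \<open>push \<alpha>\<close> is contractive: the error \<open>f - g\<close> costs at most
  \<open>\<epsilon> / 2\<close> in each of the two seminorms.\<close>

lemma seminorm_push:
  assumes f: "f \<in> formals Y X"
  shows "tgt.seminorm (push \<alpha> f) = src.seminorm f"
proof (rule antisym[OF seminorm_push_le[OF f]], rule field_le_epsilon)
  fix \<epsilon> :: real
  assume "0 < \<epsilon>"
  then obtain g where g: "g \<in> formals Y (alg_hilbert_tensor t)" "src.seminorm (f - g) < \<epsilon> / 2"
    using src.approx_alg[OF f] by (meson half_gt_zero)
  have gX: "g \<in> formals Y X"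
    using g(1) formals_mono[OF alg_subset] by blast
  have fg: "f - g \<in> formals Y X"
    using f gX by (rule cvec.subspace_diff[OF formals_subspace])
  have "finite (snd ` Poly_Mapping.keys g)" "snd ` Poly_Mapping.keys g \<subseteq> alg_hilbert_tensor t"
    using g(1) by (auto simp: formals_def)
  then obtain S where S: "finite S" "orthonormal S" "snd ` Poly_Mapping.keys g \<subseteq> trunc_space S"
    by (rule finite_alg_in_trunc_space)
  have gS: "g \<in> formals Y (trunc_space S)"
    using g(1) S(3) by (fastforce simp: formals_def)
  have "src.seminorm f \<le> src.seminorm g + \<epsilon> / 2"
    using src.seminorm_add_le[OF gX fg] g(2) by simp
  also have "src.seminorm g \<le> tgt.seminorm (push \<alpha> g)"
    by (rule seminorm_le_push_trunc[OF S(1,2) gS])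
  also have "push \<alpha> g = push \<alpha> f - push \<alpha> (f - g)"
    by (simp add: push_eq_ext ext_diff)
  also have "tgt.seminorm \<dots> \<le> tgt.seminorm (push \<alpha> f) + tgt.seminorm (push \<alpha> (f - g))"
    by (rule tgt.seminorm_diff_le[OF push_formals[OF f] push_formals[OF fg]])
  also have "tgt.seminorm (push \<alpha> (f - g)) \<le> \<epsilon> / 2"
    using seminorm_push_le[OF fg] g(2) by simp
  finally show "src.seminorm f \<le> tgt.seminorm (push \<alpha> f) + \<epsilon>"
    by simp
qed

lemma mod_tensor_norm_map:
  assumes "U \<in> mod_tensor Y m X act"
  shows "mod_tensor_norm Z X (mod_tensor_map Z n X act \<alpha> U) = mod_tensor_norm Y X U"
proof -
  obtain f where f: "f \<in> formals Y X" "U = mod_tensor_class Y m X act f"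
    using assms by (auto simp: src.mod_tensor_eq)
  show ?thesis
    using f(1) unfolding f(2)
    by (simp add: mod_tensor_map_class src.mod_tensor_norm_class tgt.mod_tensor_norm_class
        push_formals seminorm_push)
qed

end

lemma (in htensor) ESR_flat_act:
  assumes inf: "\<not> (\<exists>B :: 'l set. finite B \<and> cspan B = UNIV)"
    and X: "csubspace X" "alg_hilbert_tensor t \<subseteq> X" "\<And>a \<zeta>. a \<in> bops \<Longrightarrow> \<zeta> \<in> X \<Longrightarrow> act a \<zeta> \<in> X"
  shows "ESR_flat TYPE('y::complex_normed_vector) TYPE('z::complex_normed_vector) X act"
  unfolding ESR_flat_def
proof (intro conjI allI impI ballI)
  show left: "contractive_left_module X act"
    using X(1,3) by (rule contractive_left_module_act)
  fix Y :: "'y set" and m and Z :: "'z set" and n \<alpha> U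
  assume *: "right_semi_Ruan Y m \<and> right_semi_Ruan Z n \<and> right_morphism Y m Z n \<alpha> \<and>
    (\<forall>y\<in>Y. norm (\<alpha> y) = norm y)" and U: "U \<in> mod_tensor Y m X act"
  interpret htensor_morphism t Y m Z n X \<alpha>
    using * left X(2) inf by unfold_locales (auto simp: right_semi_Ruan_def)
  show "mod_tensor_norm Z X (mod_tensor_map Z n X act \<alpha> U) = mod_tensor_norm Y X U"
    using U by (rule mod_tensor_norm_map)
qed

theorem theorem1:
  fixes t :: "'l::chilbert_space \<Rightarrow> 'h::chilbert_space \<Rightarrow> 't::chilbert_space"
  assumes "separable_space (euclidean :: 'l topology)"
    and "\<not> (\<exists>B :: 'l set. finite B \<and> cspan B = UNIV)"
    and "hilbert_tensor t"
  shows "ESR_flat TYPE('y::complex_normed_vector) TYPE('z::complex_normed_vector)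
           (alg_hilbert_tensor t) (hilbert_tensor_action t) \<and>
         ESR_flat TYPE('y) TYPE('z) UNIV (hilbert_tensor_action t)"
proof -
  interpret htensor t
    using assms(3) by unfold_locales
  show ?thesis
    using assms(2) alg_hilbert_tensor_subspace act_alg
    by (intro conjI ESR_flat_act) auto
qed

end
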